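(* Let $V\to M$ be a representation of a Lie algebroid $A\Rightarrow M$, with flat $A$-connection $\nabla^A$. (i) For any linear connection $\nabla$ on $V\to M$, its $A$-invariance form $(T,\theta)$, given by $$\theta(\alpha)=\nabla^A_\alpha-\nabla_{\rho(\alpha)}\in\Gamma(\mathrm{End}V),\qquad T(\alpha)=\mathrm d^{\nabla}\theta(\alpha)-\iota_{\rho(\alpha)}R^\nabla\in\Omega^1(M;\mathrm{End}V)\qquad(\alpha\in\Gamma(A)),$$ is infinitesimally multiplicative: $(T,\theta)\in\Omega^1_{im}(A;\mathrm{End}V)$. (ii) The set $\mathcal A_{\mathrm{inv}}(A;V)$ of $A$-invariant linear connections on $V$ is (if nonempty) an affine space over the space $\Omega^1_{\mathrm{inv}}(M;\mathrm{End}V)$ of invariant endomorphism-valued 1-forms. (iii) The cohomology class of the $A$-invariance form $(T,\theta)$ of a connection $\nabla$ on $V$ is independent of the choice of $\nabla$. Denote it by $\mathrm{obs}_{\mathcal A_{\mathrm{inv}}(A;V)}:=[(T,\theta)]\in H^{1,1}(A;\mathrm{End}V)$. (iv) An $A$-invariant connection on $V$ exists if and only if $\mathrm{obs}_{\mathcal A_{\mathrm{inv}}(A;V)}=0$.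
   Context: $\rho$ is the anchor of $A$, $R^\nabla$ the curvature of $\nabla$; $\mathrm d^\nabla\theta(\alpha)$ uses the induced connection on $\mathrm{End}V$. A connection $\nabla$ is $A$-invariant if $\nabla^A_\alpha=\nabla_{\rho(\alpha)}$ and $\iota_{\rho(\alpha)}R^\nabla=0$ for all $\alpha\in A$. $\mathrm{End}V$ carries the induced representation $(\nabla^A_\alpha F)\xi=\nabla^A_\alpha(F\xi)-F\nabla^A_\alpha\xi$. For a representation $(W,\nabla^A)$ of $A$ and $\gamma\in\Omega^m(M;W)$ put $(\mathcal L^A_\alpha\gamma)(X_1,\dots,X_m)=\nabla^A_\alpha(\gamma(X_1,\dots,X_m))-\sum_j\gamma(X_1,\dots,[\rho(\alpha),X_j],\dots,X_m)$. An element $c=(c_0,c_1)\in W^{1,q}(A;W)$ consists of an $\mathbb R$-linear map $c_0\colon\Gamma(A)\to\Omega^q(M;W)$ and a $C^\infty(M)$-linear map $c_1\colon\Gamma(A)\to\Omega^{q-1}(M;W)$ with $c_0(f\alpha)=fc_0(\alpha)+\mathrm df\wedge c_1(\alpha)$. It is an IM form, $c\in\Omega^q_{im}(A;W)$, if for all $\alpha,\beta\in\Gamma(A)$: $$c_0([\alpha,\beta])=\mathcal L^A_\alpha c_0(\beta)-\mathcal L^A_\beta c_0(\alpha),\quad c_1([\alpha,\beta])=\mathcal L^A_\alpha(c_1(\beta))-\iota_{\rho(\beta)}c_0(\alpha),\quad \iota_{\rho(\alpha)}c_1(\beta)=-\iota_{\rho(\beta)}c_1(\alpha).$$ Define $\delta^0\colon\Omega^q(M;W)\to\Omega^q_{im}(A;W)$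 by $(\delta^0\gamma)_0(\alpha)=\mathcal L^A_\alpha\gamma$, $(\delta^0\gamma)_1(\alpha)=\iota_{\rho(\alpha)}\gamma$. Then $H^{1,q}(A;W)=\Omega^q_{im}(A;W)/\mathrm{im}\,\delta^0$ and $\Omega^q_{\mathrm{inv}}(M;W)=\ker\delta^0$. *)

theory Defs
  imports "HOL-Analysis.Analysis" "HOL-Library.Function_Algebras"
begin

text \<open>
  Functions into a real vector space form a real vector space under the pointwise operations.
  Sections, endomorphisms of sections, differential forms and connections below all live in such
  function spaces, so that \<open>+\<close>, \<open>-\<close>, \<open>0\<close> and \<open>subspace\<close> have their usual meaning for them.  To make
  equality of such objects meaningful, a map that is mathematically defined only on a subset of a
  type (smooth functions, sections, vector fields, ...) is required to be \<open>0\<close> off that subset,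
  wherever equality of these maps matters.
\<close>

instantiation "fun" :: (type, real_vector) real_vector
begin

definition scaleR_fun :: "real \<Rightarrow> ('a \<Rightarrow> 'b) \<Rightarrow> 'a \<Rightarrow> 'b"
  where "scaleR_fun c f = (\<lambda>x. c *\<^sub>R f x)"

instance
  by standard (simp_all add: scaleR_fun_def fun_eq_iff scaleR_add_right scaleR_add_left)

end

section \<open>Smooth manifolds\<close>

text \<open>
  \<open>Ck n k U f\<close>: \<open>f\<close> is of class \<open>C\<^sup>k\<close> on \<open>U\<close>, an open subset of \<open>Euclidean_space n\<close>, whose points
  are the functions \<open>nat \<Rightarrow> real\<close> vanishing at all indices \<open>\<ge> n\<close>.  Here \<open>g i\<close> is the partial
  derivative of \<open>f\<close> in the \<open>i\<close>-th coordinate.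
\<close>

primrec Ck :: "nat \<Rightarrow> nat \<Rightarrow> (nat \<Rightarrow> real) set \<Rightarrow> ((nat \<Rightarrow> real) \<Rightarrow> real) \<Rightarrow> bool" where
  "Ck n 0 U f = continuous_on U f"
| "Ck n (Suc k) U f =
     (continuous_on U f \<and>
      (\<exists>g. \<forall>i<n. Ck n k U (g i) \<and>
         (\<forall>x\<in>U. ((\<lambda>t. f (x(i := t))) has_real_derivative g i x) (at (x i)))))"

definition Cinf_Euclidean :: "nat \<Rightarrow> (nat \<Rightarrow> real) set \<Rightarrow> ((nat \<Rightarrow> real) \<Rightarrow> real) \<Rightarrow> bool" where
  "Cinf_Euclidean n U f \<longleftrightarrow> (\<forall>k. Ck n k U f)"

record 'm manifold =
  dimension :: nat
  charts :: "('m set \<times> ('m \<Rightarrow> nat \<Rightarrow> real)) set"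

text \<open>The underlying topological space is a whole type, Hausdorff and second countable.\<close>

definition smooth_manifold ::
    "'m::{t2_space, second_countable_topology} manifold \<Rightarrow> bool" where
  "smooth_manifold M \<longleftrightarrow>
     (\<Union>(U, \<phi>)\<in>charts M. U) = UNIV \<and>
     (\<forall>(U, \<phi>)\<in>charts M. open U \<and> openin (Euclidean_space (dimension M)) (\<phi> ` U) \<and>
        homeomorphic_map (top_of_set U)
          (subtopology (Euclidean_space (dimension M)) (\<phi> ` U)) \<phi>) \<and>
     (\<forall>(U, \<phi>)\<in>charts M. \<forall>(U', \<phi>')\<in>charts M. \<forall>i<dimension M.
        Cinf_Euclidean (dimension M) (\<phi> ` (U \<inter> U')) (\<lambda>y. \<phi>' (inv_into U \<phi> y) i))"

definition smooth_on :: "'m manifold \<Rightarrow> 'm set \<Rightarrow> ('m \<Rightarrow> real) \<Rightarrow> bool" where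
  "smooth_on M S f \<longleftrightarrow>
     (\<forall>(U, \<phi>)\<in>charts M. Cinf_Euclidean (dimension M) (\<phi> ` (U \<inter> S)) (\<lambda>y. f (inv_into U \<phi> y)))"

definition smooth_functions :: "'m manifold \<Rightarrow> ('m \<Rightarrow> real) set" where
  "smooth_functions M = {f. smooth_on M UNIV f}"

text \<open>Tangent vectors at \<open>x\<close> are the derivations at \<open>x\<close> of the algebra of smooth functions.\<close>

type_synonym 'm tangent_vector = "('m \<Rightarrow> real) \<Rightarrow> real"

definition tangent_space :: "'m manifold \<Rightarrow> 'm \<Rightarrow> 'm tangent_vector set" where
  "tangent_space M x =
     {v. (\<forall>f\<in>smooth_functions M. \<forall>g\<in>smooth_functions M.
            v (f + g) = v f + v g \<and>
            (\<forall>a::real. v (a *\<^sub>R f) = a * v f) \<and>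
            v (f * g) = f x * v g + g x * v f) \<and>
         (\<forall>f. f \<notin> smooth_functions M \<longrightarrow> v f = 0)}"

type_synonym 'm vector_field = "'m \<Rightarrow> 'm tangent_vector"

text \<open>The function \<open>X f\<close>, i.e. \<open>df(X)\<close>.\<close>

definition vf_apply :: "'m vector_field \<Rightarrow> ('m \<Rightarrow> real) \<Rightarrow> 'm \<Rightarrow> real" where
  "vf_apply X f = (\<lambda>x. X x f)"

definition vector_fields :: "'m manifold \<Rightarrow> 'm vector_field set" where
  "vector_fields M =
     {X. (\<forall>x. X x \<in> tangent_space M x) \<and>
         (\<forall>f\<in>smooth_functions M. vf_apply X f \<in> smooth_functions M)}"

definition vf_bracket :: "'m vector_field \<Rightarrow> 'm vector_field \<Rightarrow> 'm vector_field" where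
  "vf_bracket X Y = (\<lambda>x f. X x (vf_apply Y f) - Y x (vf_apply X f))"

text \<open>The product of a function with a section of a bundle, or with a vector field.\<close>

definition fmult :: "('m \<Rightarrow> real) \<Rightarrow> ('m \<Rightarrow> 'v::real_vector) \<Rightarrow> 'm \<Rightarrow> 'v" (infixr "\<cdot>" 75) where
  "f \<cdot> s = (\<lambda>x. f x *\<^sub>R s x)"

section \<open>Vector bundles\<close>

text \<open>
  The fibres are subspaces of a real vector space \<open>'v\<close>; this is no restriction, since any family of
  vector spaces embeds in its direct sum.  The type \<open>'v\<close> carries neither a topology nor a
  trivialisation: the smooth structure comes from an atlas of local frames alone.
\<close>

record ('m, 'v) vbundle =
  rank :: nat
  fibre :: "'m \<Rightarrow> 'v set"
  frames :: "('m set \<times> (nat \<Rightarrow> 'm \<Rightarrow> 'v)) set"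

definition vector_bundle ::
    "'m::{t2_space, second_countable_topology} manifold \<Rightarrow> ('m, 'v::real_vector) vbundle \<Rightarrow> bool"
where
  "vector_bundle M E \<longleftrightarrow>
     (\<Union>(U, e)\<in>frames E. U) = UNIV \<and>
     (\<forall>(U, e)\<in>frames E. open U \<and>
        (\<forall>x\<in>U. inj_on (\<lambda>i. e i x) {..<rank E} \<and>
               independent ((\<lambda>i. e i x) ` {..<rank E}) \<and>
               span ((\<lambda>i. e i x) ` {..<rank E}) = fibre E x)) \<and>
     (\<forall>(U, e)\<in>frames E. \<forall>(U', e')\<in>frames E. \<exists>g.
        (\<forall>i<rank E. \<forall>j<rank E. smooth_on M (U \<inter> U') (g i j)) \<and>
        (\<forall>x\<in>U \<inter> U'. \<forall>j<rank E. e' j x = (\<Sum>i<rank E. g i j x *\<^sub>R e i x)))"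

definition sections :: "'m manifold \<Rightarrow> ('m, 'v::real_vector) vbundle \<Rightarrow> ('m \<Rightarrow> 'v) set" where
  "sections M E =
     {s. (\<forall>x. s x \<in> fibre E x) \<and>
         (\<forall>(U, e)\<in>frames E. \<exists>a. (\<forall>i<rank E. smooth_on M U (a i)) \<and>
            (\<forall>x\<in>U. s x = (\<Sum>i<rank E. a i x *\<^sub>R e i x)))}"

text \<open>
  The data of a bundle \<open>W\<close> entering differential forms with values in \<open>W\<close> is the module of its
  sections over the smooth functions.  Sections of \<open>End V\<close> are identified, as usual, with the
  endomorphisms of the module of sections of \<open>V\<close> that are linear over the smooth functions.
\<close>

record ('m, 'w) section_module =
  secs :: "'w set"
  act :: "('m \<Rightarrow> real) \<Rightarrow> 'w \<Rightarrow> 'w"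

definition bundle_module ::
    "'m manifold \<Rightarrow> ('m, 'v::real_vector) vbundle \<Rightarrow> ('m, 'm \<Rightarrow> 'v) section_module" where
  "bundle_module M V = \<lparr>secs = sections M V, act = (\<lambda>f s. f \<cdot> s)\<rparr>"

definition End_module ::
    "'m manifold \<Rightarrow> ('m, 'v::real_vector) vbundle
       \<Rightarrow> ('m, ('m \<Rightarrow> 'v) \<Rightarrow> 'm \<Rightarrow> 'v) section_module" where
  "End_module M V =
     \<lparr>secs = {F. (\<forall>\<xi>\<in>sections M V. F \<xi> \<in> sections M V) \<and>
                 (\<forall>\<xi>\<in>sections M V. \<forall>\<eta>\<in>sections M V. F (\<xi> + \<eta>) = F \<xi> + F \<eta>) \<and>
                 (\<forall>f\<in>smooth_functions M. \<forall>\<xi>\<in>sections M V. F (f \<cdot> \<xi>) = f \<cdot> F \<xi>) \<and>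
                 (\<forall>\<xi>. \<xi> \<notin> sections M V \<longrightarrow> F \<xi> = 0)},
      act = (\<lambda>f F \<xi>. f \<cdot> F \<xi>)\<rparr>"

section \<open>Lie algebroids and representations\<close>

record ('m, 'a) lie_algebroid =
  abundle :: "('m, 'a) vbundle"
  anchor :: "'m \<Rightarrow> 'a \<Rightarrow> 'm tangent_vector"
  bracket :: "('m \<Rightarrow> 'a) \<Rightarrow> ('m \<Rightarrow> 'a) \<Rightarrow> 'm \<Rightarrow> 'a"

abbreviation asections ::
    "'m manifold \<Rightarrow> ('m, 'a::real_vector) lie_algebroid \<Rightarrow> ('m \<Rightarrow> 'a) set" where
  "asections M A \<equiv> sections M (abundle A)"

definition rho :: "('m, 'a) lie_algebroid \<Rightarrow> ('m \<Rightarrow> 'a) \<Rightarrow> 'm vector_field" where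
  "rho A \<alpha> = (\<lambda>x. anchor A x (\<alpha> x))"

definition lie_algebroid ::
    "'m::{t2_space, second_countable_topology} manifold
       \<Rightarrow> ('m, 'a::real_vector) lie_algebroid \<Rightarrow> bool" where
  "lie_algebroid M A \<longleftrightarrow>
     vector_bundle M (abundle A) \<and>
     \<comment> \<open>the anchor is a vector bundle morphism to the tangent bundle\<close>
     (\<forall>x. \<forall>u\<in>fibre (abundle A) x. anchor A x u \<in> tangent_space M x) \<and>
     (\<forall>x. \<forall>u\<in>fibre (abundle A) x. \<forall>v\<in>fibre (abundle A) x. \<forall>a b.
        anchor A x (a *\<^sub>R u + b *\<^sub>R v) = a *\<^sub>R anchor A x u + b *\<^sub>R anchor A x v) \<and>
     (\<forall>\<alpha>\<in>asections M A. rho A \<alpha> \<in> vector_fields M) \<and>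
     \<comment> \<open>the bracket is a Lie bracket on sections\<close>
     (\<forall>\<alpha>\<in>asections M A. \<forall>\<beta>\<in>asections M A. bracket A \<alpha> \<beta> \<in> asections M A) \<and>
     (\<forall>\<alpha>\<in>asections M A. \<forall>\<beta>\<in>asections M A. \<forall>\<gamma>\<in>asections M A. \<forall>a b.
        bracket A \<alpha> (a *\<^sub>R \<beta> + b *\<^sub>R \<gamma>) = a *\<^sub>R bracket A \<alpha> \<beta> + b *\<^sub>R bracket A \<alpha> \<gamma>) \<and>
     (\<forall>\<alpha>\<in>asections M A. \<forall>\<beta>\<in>asections M A. bracket A \<beta> \<alpha> = - bracket A \<alpha> \<beta>) \<and>
     (\<forall>\<alpha>\<in>asections M A. \<forall>\<beta>\<in>asections M A. \<forall>\<gamma>\<in>asections M A.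
        bracket A \<alpha> (bracket A \<beta> \<gamma>)
          = bracket A (bracket A \<alpha> \<beta>) \<gamma> + bracket A \<beta> (bracket A \<alpha> \<gamma>)) \<and>
     \<comment> \<open>compatibility of bracket and anchor\<close>
     (\<forall>\<alpha>\<in>asections M A. \<forall>\<beta>\<in>asections M A. \<forall>f\<in>smooth_functions M.
        bracket A \<alpha> (f \<cdot> \<beta>) = f \<cdot> bracket A \<alpha> \<beta> + vf_apply (rho A \<alpha>) f \<cdot> \<beta>) \<and>
     (\<forall>\<alpha>\<in>asections M A. \<forall>\<beta>\<in>asections M A.
        rho A (bracket A \<alpha> \<beta>) = vf_bracket (rho A \<alpha>) (rho A \<beta>))"

definition algebroid_representation ::
    "'m manifold \<Rightarrow> ('m, 'a::real_vector) lie_algebroid \<Rightarrow> ('m, 'w::real_vector) section_module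
       \<Rightarrow> (('m \<Rightarrow> 'a) \<Rightarrow> 'w \<Rightarrow> 'w) \<Rightarrow> bool" where
  "algebroid_representation M A W D \<longleftrightarrow>
     \<comment> \<open>\<open>D\<close> is an \<open>A\<close>-connection\<close>
     (\<forall>\<alpha>\<in>asections M A. \<forall>w\<in>secs W. D \<alpha> w \<in> secs W) \<and>
     (\<forall>\<alpha>\<in>asections M A. \<forall>\<beta>\<in>asections M A. \<forall>w\<in>secs W. D (\<alpha> + \<beta>) w = D \<alpha> w + D \<beta> w) \<and>
     (\<forall>f\<in>smooth_functions M. \<forall>\<alpha>\<in>asections M A. \<forall>w\<in>secs W. D (f \<cdot> \<alpha>) w = act W f (D \<alpha> w)) \<and>
     (\<forall>\<alpha>\<in>asections M A. \<forall>w\<in>secs W. \<forall>z\<in>secs W. D \<alpha> (w + z) = D \<alpha> w + D \<alpha> z) \<and>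
     (\<forall>\<alpha>\<in>asections M A. \<forall>f\<in>smooth_functions M. \<forall>w\<in>secs W.
        D \<alpha> (act W f w) = act W f (D \<alpha> w) + act W (vf_apply (rho A \<alpha>) f) w) \<and>
     \<comment> \<open>\<open>D\<close> is flat\<close>
     (\<forall>\<alpha>\<in>asections M A. \<forall>\<beta>\<in>asections M A. \<forall>w\<in>secs W.
        D (bracket A \<alpha> \<beta>) w = D \<alpha> (D \<beta> w) - D \<beta> (D \<alpha> w))"

text \<open>
  The connection on \<open>End V\<close> induced by a connection \<open>D\<close> on \<open>V\<close>; \<open>D\<close> may be an \<open>A\<close>-connection
  (\<open>'s\<close> is then the type of sections of \<open>A\<close>) or a linear connection (\<open>'s\<close> is then the type of
  vector fields).
\<close>

definition End_connection ::
    "'m manifold \<Rightarrow> ('m, 'v::real_vector) vbundle \<Rightarrow> ('s \<Rightarrow> ('m \<Rightarrow> 'v) \<Rightarrow> 'm \<Rightarrow> 'v)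
       \<Rightarrow> 's \<Rightarrow> (('m \<Rightarrow> 'v) \<Rightarrow> 'm \<Rightarrow> 'v) \<Rightarrow> ('m \<Rightarrow> 'v) \<Rightarrow> 'm \<Rightarrow> 'v" where
  "End_connection M V D s F = (\<lambda>\<xi>. if \<xi> \<in> sections M V then D s (F \<xi>) - F (D s \<xi>) else 0)"

section \<open>Differential forms with values in a bundle\<close>

text \<open>
  A \<open>q\<close>-form is an alternating multilinear map, over the smooth functions, on lists of \<open>q\<close> vector
  fields.  A \<open>0\<close>-form is thus given by its value at the empty list.
\<close>

type_synonym ('m, 'w) form = "'m vector_field list \<Rightarrow> 'w"

definition forms ::
    "'m manifold \<Rightarrow> ('m, 'w::real_vector) section_module \<Rightarrow> nat \<Rightarrow> ('m, 'w) form set" where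
  "forms M W q =
     {\<gamma>. (\<forall>Xs. length Xs = q \<and> set Xs \<subseteq> vector_fields M \<longrightarrow> \<gamma> Xs \<in> secs W) \<and>
         (\<forall>Xs. \<not> (length Xs = q \<and> set Xs \<subseteq> vector_fields M) \<longrightarrow> \<gamma> Xs = 0) \<and>
         (\<forall>Xs i. length Xs = q \<and> set Xs \<subseteq> vector_fields M \<and> i < q \<longrightarrow>
            (\<forall>X\<in>vector_fields M. \<forall>Y\<in>vector_fields M. \<forall>f\<in>smooth_functions M.
               \<gamma> (Xs[i := f \<cdot> X + Y]) = act W f (\<gamma> (Xs[i := X])) + \<gamma> (Xs[i := Y]))) \<and>
         (\<forall>Xs i j. length Xs = q \<and> set Xs \<subseteq> vector_fields M \<and> i < j \<and> j < q \<and> Xs ! i = Xs ! j \<longrightarrow>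
            \<gamma> Xs = 0)}"

definition zero_form :: "'w::real_vector \<Rightarrow> ('m, 'w) form" where
  "zero_form w = (\<lambda>Xs. if Xs = [] then w else 0)"

text \<open>On \<open>0\<close>-forms this contraction is \<open>0\<close>, because they vanish on nonempty lists.\<close>

definition contract :: "'m vector_field \<Rightarrow> ('m, 'w) form \<Rightarrow> ('m, 'w) form" where
  "contract X \<gamma> = (\<lambda>Xs. \<gamma> (X # Xs))"

definition form_act ::
    "('m, 'w) section_module \<Rightarrow> ('m \<Rightarrow> real) \<Rightarrow> ('m, 'w) form \<Rightarrow> ('m, 'w) form" where
  "form_act W f \<gamma> = (\<lambda>Xs. act W f (\<gamma> Xs))"

text \<open>The wedge product \<open>df \<and> \<gamma>\<close>.\<close>

definition d_wedge ::
    "'m manifold \<Rightarrow> ('m, 'w::real_vector) section_module \<Rightarrow> ('m \<Rightarrow> real) \<Rightarrow> ('m, 'w) form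
       \<Rightarrow> ('m, 'w) form" where
  "d_wedge M W f \<gamma> =
     (\<lambda>Xs. if set Xs \<subseteq> vector_fields M
           then \<Sum>i<length Xs. (-1) ^ i *\<^sub>R
                  act W (vf_apply (Xs ! i) f) (\<gamma> (take i Xs @ drop (Suc i) Xs))
           else 0)"

definition lie_derivative ::
    "'m manifold \<Rightarrow> ('m, 'a::real_vector) lie_algebroid \<Rightarrow> (('m \<Rightarrow> 'a) \<Rightarrow> 'w \<Rightarrow> 'w)
       \<Rightarrow> ('m \<Rightarrow> 'a) \<Rightarrow> ('m, 'w::real_vector) form \<Rightarrow> ('m, 'w) form" where
  "lie_derivative M A D \<alpha> \<gamma> =
     (\<lambda>Xs. if set Xs \<subseteq> vector_fields M
           then D \<alpha> (\<gamma> Xs) - (\<Sum>j<length Xs. \<gamma> (Xs[j := vf_bracket (rho A \<alpha>) (Xs ! j)]))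
           else 0)"

section \<open>Infinitesimally multiplicative forms and their cohomology\<close>

type_synonym ('m, 'a, 'w) weil_cochain =
  "(('m \<Rightarrow> 'a) \<Rightarrow> ('m, 'w) form) \<times> (('m \<Rightarrow> 'a) \<Rightarrow> ('m, 'w) form)"

text \<open>The space \<open>W\<^bsup>1,q\<^esup>(A;W)\<close>; forms of degree \<open>-1\<close> are \<open>0\<close>.\<close>

definition weil_cochains ::
    "'m manifold \<Rightarrow> ('m, 'a::real_vector) lie_algebroid \<Rightarrow> ('m, 'w::real_vector) section_module
       \<Rightarrow> nat \<Rightarrow> ('m, 'a, 'w) weil_cochain set" where
  "weil_cochains M A W q =
     {(c0, c1).
        (\<forall>\<alpha>\<in>asections M A. c0 \<alpha> \<in> forms M W q) \<and>
        (\<forall>\<alpha>\<in>asections M A. c1 \<alpha> \<in> (if q = 0 then {0} else forms M W (q - 1))) \<and>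
        (\<forall>\<alpha>\<in>asections M A. \<forall>\<beta>\<in>asections M A. \<forall>a b.
           c0 (a *\<^sub>R \<alpha> + b *\<^sub>R \<beta>) = a *\<^sub>R c0 \<alpha> + b *\<^sub>R c0 \<beta>) \<and>
        (\<forall>\<alpha>\<in>asections M A. \<forall>\<beta>\<in>asections M A. c1 (\<alpha> + \<beta>) = c1 \<alpha> + c1 \<beta>) \<and>
        (\<forall>f\<in>smooth_functions M. \<forall>\<alpha>\<in>asections M A. c1 (f \<cdot> \<alpha>) = form_act W f (c1 \<alpha>)) \<and>
        (\<forall>f\<in>smooth_functions M. \<forall>\<alpha>\<in>asections M A.
           c0 (f \<cdot> \<alpha>) = form_act W f (c0 \<alpha>) + d_wedge M W f (c1 \<alpha>)) \<and>
        (\<forall>\<alpha>. \<alpha> \<notin> asections M A \<longrightarrow> c0 \<alpha> = 0 \<and> c1 \<alpha> = 0)}"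

definition im_forms ::
    "'m manifold \<Rightarrow> ('m, 'a::real_vector) lie_algebroid \<Rightarrow> ('m, 'w::real_vector) section_module
       \<Rightarrow> (('m \<Rightarrow> 'a) \<Rightarrow> 'w \<Rightarrow> 'w) \<Rightarrow> nat \<Rightarrow> ('m, 'a, 'w) weil_cochain set" where
  "im_forms M A W D q =
     {(c0, c1). (c0, c1) \<in> weil_cochains M A W q \<and>
        (\<forall>\<alpha>\<in>asections M A. \<forall>\<beta>\<in>asections M A.
           c0 (bracket A \<alpha> \<beta>)
             = lie_derivative M A D \<alpha> (c0 \<beta>) - lie_derivative M A D \<beta> (c0 \<alpha>) \<and>
           c1 (bracket A \<alpha> \<beta>)
             = lie_derivative M A D \<alpha> (c1 \<beta>) - contract (rho A \<beta>) (c0 \<alpha>) \<and>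
           contract (rho A \<alpha>) (c1 \<beta>) = - contract (rho A \<beta>) (c1 \<alpha>))}"

definition delta0 ::
    "'m manifold \<Rightarrow> ('m, 'a::real_vector) lie_algebroid \<Rightarrow> (('m \<Rightarrow> 'a) \<Rightarrow> 'w \<Rightarrow> 'w)
       \<Rightarrow> ('m, 'w::real_vector) form \<Rightarrow> ('m, 'a, 'w) weil_cochain" where
  "delta0 M A D \<gamma> =
     ((\<lambda>\<alpha>. if \<alpha> \<in> asections M A then lie_derivative M A D \<alpha> \<gamma> else 0),
      (\<lambda>\<alpha>. if \<alpha> \<in> asections M A then contract (rho A \<alpha>) \<gamma> else 0))"

definition invariant_forms ::
    "'m manifold \<Rightarrow> ('m, 'a::real_vector) lie_algebroid \<Rightarrow> ('m, 'w::real_vector) section_module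
       \<Rightarrow> (('m \<Rightarrow> 'a) \<Rightarrow> 'w \<Rightarrow> 'w) \<Rightarrow> nat \<Rightarrow> ('m, 'w) form set" where
  "invariant_forms M A W D q = {\<gamma> \<in> forms M W q. delta0 M A D \<gamma> = 0}"

text \<open>Elements of the quotient \<open>H\<^bsup>1,q\<^esup>(A;W)\<close> are the cosets of the image of \<open>delta0\<close>.\<close>

definition cohomology_class ::
    "'m manifold \<Rightarrow> ('m, 'a::real_vector) lie_algebroid \<Rightarrow> ('m, 'w::real_vector) section_module
       \<Rightarrow> (('m \<Rightarrow> 'a) \<Rightarrow> 'w \<Rightarrow> 'w) \<Rightarrow> nat \<Rightarrow> ('m, 'a, 'w) weil_cochain
       \<Rightarrow> ('m, 'a, 'w) weil_cochain set" where
  "cohomology_class M A W D q c = {c + b | b. b \<in> delta0 M A D ` forms M W q}"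

definition H1 ::
    "'m manifold \<Rightarrow> ('m, 'a::real_vector) lie_algebroid \<Rightarrow> ('m, 'w::real_vector) section_module
       \<Rightarrow> (('m \<Rightarrow> 'a) \<Rightarrow> 'w \<Rightarrow> 'w) \<Rightarrow> nat \<Rightarrow> ('m, 'a, 'w) weil_cochain set set" where
  "H1 M A W D q = cohomology_class M A W D q ` im_forms M A W D q"

section \<open>Linear connections and their invariance forms\<close>

type_synonym ('m, 'v) connection = "'m vector_field \<Rightarrow> ('m \<Rightarrow> 'v) \<Rightarrow> 'm \<Rightarrow> 'v"

definition linear_connections ::
    "'m manifold \<Rightarrow> ('m, 'v::real_vector) vbundle \<Rightarrow> ('m, 'v) connection set" where
  "linear_connections M V =
     {N. (\<forall>X\<in>vector_fields M. \<forall>\<xi>\<in>sections M V. N X \<xi> \<in> sections M V) \<and>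
         (\<forall>X\<in>vector_fields M. \<forall>Y\<in>vector_fields M. \<forall>\<xi>\<in>sections M V.
            N (X + Y) \<xi> = N X \<xi> + N Y \<xi>) \<and>
         (\<forall>f\<in>smooth_functions M. \<forall>X\<in>vector_fields M. \<forall>\<xi>\<in>sections M V.
            N (f \<cdot> X) \<xi> = f \<cdot> N X \<xi>) \<and>
         (\<forall>X\<in>vector_fields M. \<forall>\<xi>\<in>sections M V. \<forall>\<eta>\<in>sections M V.
            N X (\<xi> + \<eta>) = N X \<xi> + N X \<eta>) \<and>
         (\<forall>X\<in>vector_fields M. \<forall>f\<in>smooth_functions M. \<forall>\<xi>\<in>sections M V.
            N X (f \<cdot> \<xi>) = f \<cdot> N X \<xi> + vf_apply X f \<cdot> \<xi>) \<and>
         (\<forall>X \<xi>. X \<notin> vector_fields M \<or> \<xi> \<notin> sections M V \<longrightarrow> N X \<xi> = 0)}"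

definition curvature ::
    "'m manifold \<Rightarrow> ('m, 'v::real_vector) vbundle \<Rightarrow> ('m, 'v) connection
       \<Rightarrow> ('m, ('m \<Rightarrow> 'v) \<Rightarrow> 'm \<Rightarrow> 'v) form" where
  "curvature M V N =
     (\<lambda>Xs. if length Xs = 2 \<and> set Xs \<subseteq> vector_fields M
           then (let X = Xs ! 0; Y = Xs ! 1 in
                 (\<lambda>\<xi>. if \<xi> \<in> sections M V
                      then N X (N Y \<xi>) - N Y (N X \<xi>) - N (vf_bracket X Y) \<xi>
                      else 0))
           else 0)"

text \<open>The \<open>1\<close>-form \<open>d\<^sup>\<nabla>F\<close> for a section \<open>F\<close> of \<open>End V\<close>.\<close>

definition d_End ::
    "'m manifold \<Rightarrow> ('m, 'v::real_vector) vbundle \<Rightarrow> ('m, 'v) connection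
       \<Rightarrow> (('m \<Rightarrow> 'v) \<Rightarrow> 'm \<Rightarrow> 'v) \<Rightarrow> ('m, ('m \<Rightarrow> 'v) \<Rightarrow> 'm \<Rightarrow> 'v) form" where
  "d_End M V N F =
     (\<lambda>Xs. if length Xs = 1 \<and> set Xs \<subseteq> vector_fields M
           then End_connection M V N (Xs ! 0) F else 0)"

definition theta ::
    "'m manifold \<Rightarrow> ('m, 'a::real_vector) lie_algebroid \<Rightarrow> ('m, 'v::real_vector) vbundle
       \<Rightarrow> (('m \<Rightarrow> 'a) \<Rightarrow> ('m \<Rightarrow> 'v) \<Rightarrow> 'm \<Rightarrow> 'v) \<Rightarrow> ('m, 'v) connection
       \<Rightarrow> ('m \<Rightarrow> 'a) \<Rightarrow> ('m \<Rightarrow> 'v) \<Rightarrow> 'm \<Rightarrow> 'v" where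
  "theta M A V D N \<alpha> = (\<lambda>\<xi>. if \<xi> \<in> sections M V then D \<alpha> \<xi> - N (rho A \<alpha>) \<xi> else 0)"

definition invariance_form ::
    "'m manifold \<Rightarrow> ('m, 'a::real_vector) lie_algebroid \<Rightarrow> ('m, 'v::real_vector) vbundle
       \<Rightarrow> (('m \<Rightarrow> 'a) \<Rightarrow> ('m \<Rightarrow> 'v) \<Rightarrow> 'm \<Rightarrow> 'v) \<Rightarrow> ('m, 'v) connection
       \<Rightarrow> ('m, 'a, ('m \<Rightarrow> 'v) \<Rightarrow> 'm \<Rightarrow> 'v) weil_cochain" where
  "invariance_form M A V D N =
     ((\<lambda>\<alpha>. if \<alpha> \<in> asections M A
           then d_End M V N (theta M A V D N \<alpha>) - contract (rho A \<alpha>) (curvature M V N)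
           else 0),
      (\<lambda>\<alpha>. if \<alpha> \<in> asections M A then zero_form (theta M A V D N \<alpha>) else 0))"

definition invariant_connections ::
    "'m manifold \<Rightarrow> ('m, 'a::real_vector) lie_algebroid \<Rightarrow> ('m, 'v::real_vector) vbundle
       \<Rightarrow> (('m \<Rightarrow> 'a) \<Rightarrow> ('m \<Rightarrow> 'v) \<Rightarrow> 'm \<Rightarrow> 'v) \<Rightarrow> ('m, 'v) connection set" where
  "invariant_connections M A V D =
     {N \<in> linear_connections M V.
        \<forall>\<alpha>\<in>asections M A.
          (\<forall>\<xi>\<in>sections M V. D \<alpha> \<xi> = N (rho A \<alpha>) \<xi>) \<and>
          contract (rho A \<alpha>) (curvature M V N) = 0}"

text \<open>
  The common cohomology class of the invariance forms of all linear connections.  Writing it as a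
  union avoids choosing a connection: once all these classes are known to coincide, the union is
  their common value.
\<close>

definition obstruction ::
    "'m manifold \<Rightarrow> ('m, 'a::real_vector) lie_algebroid \<Rightarrow> ('m, 'v::real_vector) vbundle
       \<Rightarrow> (('m \<Rightarrow> 'a) \<Rightarrow> ('m \<Rightarrow> 'v) \<Rightarrow> 'm \<Rightarrow> 'v)
       \<Rightarrow> ('m, 'a, ('m \<Rightarrow> 'v) \<Rightarrow> 'm \<Rightarrow> 'v) weil_cochain set" where
  "obstruction M A V D =
     (\<Union>N\<in>linear_connections M V.
        cohomology_class M A (End_module M V) (End_connection M V D) 1 (invariance_form M A V D N))"

section \<open>Affine spaces\<close>

definition affine_space_over :: "'d::real_vector set \<Rightarrow> 'p set \<Rightarrow> ('p \<Rightarrow> 'd \<Rightarrow> 'p) \<Rightarrow> bool" where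
  "affine_space_over D P add \<longleftrightarrow>
     subspace D \<and> P \<noteq> {} \<and>
     (\<forall>p\<in>P. \<forall>d\<in>D. add p d \<in> P) \<and>
     (\<forall>p\<in>P. add p 0 = p) \<and>
     (\<forall>p\<in>P. \<forall>d\<in>D. \<forall>d'\<in>D. add (add p d) d' = add p (d + d')) \<and>
     (\<forall>p\<in>P. \<forall>p'\<in>P. \<exists>!d. d \<in> D \<and> add p d = p')"

definition connection_plus ::
    "('m, 'v::real_vector) connection \<Rightarrow> ('m, ('m \<Rightarrow> 'v) \<Rightarrow> 'm \<Rightarrow> 'v) form \<Rightarrow> ('m, 'v) connection"
where
  "connection_plus N \<gamma> = (\<lambda>X \<xi>. N X \<xi> + \<gamma> [X] \<xi>)"

end

theory Submission
  imports Defs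
begin

text \<open>
  Eliminating the curvature gives \<open>T(\<alpha>)(X) = \<nabla>\<^bsub>[\<rho>(\<alpha>),X]\<^esub> - [\<nabla>\<^sup>A\<^bsub>\<alpha>\<^esub>, \<nabla>\<^bsub>X\<^esub>]\<close>, so that formally
  \<open>(T, \<theta>) = (0, \<nabla>\<^sup>A) - \<delta>\<^sup>0\<nabla>\<close>.  Multiplicativity then follows from the Jacobi identity for vector
  fields and the flatness of \<open>\<nabla>\<^sup>A\<close>, and replacing \<open>\<nabla>\<close> by \<open>\<nabla> + \<gamma>\<close> changes \<open>(T, \<theta>)\<close> by \<open>-\<delta>\<^sup>0\<gamma>\<close>.  Since
  \<open>\<nabla>\<close> is invariant exactly when \<open>(T, \<theta>) = 0\<close> and the linear connections are an affine space over
  \<open>\<Omega>\<^sup>1(M; End V)\<close>, the remaining assertions are linear algebra.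
\<close>

section \<open>Smooth functions, vector fields and sections\<close>

lemma Ck_subset: "Ck n k U f \<Longrightarrow> S \<subseteq> U \<Longrightarrow> Ck n k S f"
proof (induction k arbitrary: f)
  case 0 then show ?case by (auto intro: continuous_on_subset)
next
  case (Suc k)
  then obtain g where g: "\<forall>i<n. Ck n k U (g i) \<and>
         (\<forall>x\<in>U. ((\<lambda>t. f (x(i := t))) has_real_derivative g i x) (at (x i)))" "continuous_on U f"
    by auto
  \<comment> \<open>The partial derivatives are taken along full coordinate lines, not relative to
    \<open>U\<close>, so the same \<open>g\<close> serves on \<open>S\<close>.\<close>
  then have "\<forall>i<n. Ck n k S (g i) \<and>
         (\<forall>x\<in>S. ((\<lambda>t. f (x(i := t))) has_real_derivative g i x) (at (x i)))"
    using Suc by blast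
  moreover have "continuous_on S f" using g(2) Suc.prems(2) by (rule continuous_on_subset)
  ultimately show ?case by auto
qed

text \<open>The partial derivatives drop one order by induction; at order zero only continuity of
  \<open>f\<close> is left, which \<open>Ck\<close> demands at every order.\<close>

lemma Ck_SucD: "Ck n (Suc k) U f \<Longrightarrow> Ck n k U f"
proof (induction k arbitrary: f)
  case 0 then show ?case by simp
next
  case (Suc k)
  then obtain g where "\<forall>i<n. Ck n (Suc k) U (g i) \<and>
         (\<forall>x\<in>U. ((\<lambda>t. f (x(i := t))) has_real_derivative g i x) (at (x i)))" "continuous_on U f"
    by (metis Ck.simps(2))
  then show ?case using Suc.IH unfolding Ck.simps(2)[of n k U f] by blast
qed

lemma Ck_const: "Ck n k U (\<lambda>x. c)"
proof (induction k arbitrary: c)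
  case 0 then show ?case by simp
next
  case (Suc k)
  then show ?case by (auto intro!: exI[of _ "\<lambda>i x. 0"])
qed

lemma Ck_add: "Ck n k U f \<Longrightarrow> Ck n k U g \<Longrightarrow> Ck n k U (\<lambda>x. f x + g x)"
proof (induction k arbitrary: f g)
  case 0 then show ?case by (auto intro: continuous_on_add)
next
  case (Suc k)
  from Suc.prems obtain f' g' where
    f': "\<forall>i<n. Ck n k U (f' i) \<and>
         (\<forall>x\<in>U. ((\<lambda>t. f (x(i := t))) has_real_derivative f' i x) (at (x i)))" "continuous_on U f"
    and g': "\<forall>i<n. Ck n k U (g' i) \<and>
         (\<forall>x\<in>U. ((\<lambda>t. g (x(i := t))) has_real_derivative g' i x) (at (x i)))" "continuous_on U g"
    by auto
  show ?case
    using f' g' Suc.IH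
    by (auto intro!: continuous_on_add exI[of _ "\<lambda>i x. f' i x + g' i x"] DERIV_add)
qed

lemma Ck_mult: "Ck n k U f \<Longrightarrow> Ck n k U g \<Longrightarrow> Ck n k U (\<lambda>x. f x * g x)"
proof (induction k arbitrary: f g)
  case 0 then show ?case by (auto intro: continuous_on_mult)
next
  case (Suc k)
  from Suc.prems obtain f' g' where
    f': "\<forall>i<n. Ck n k U (f' i) \<and>
         (\<forall>x\<in>U. ((\<lambda>t. f (x(i := t))) has_real_derivative f' i x) (at (x i)))" "continuous_on U f"
    and g': "\<forall>i<n. Ck n k U (g' i) \<and>
         (\<forall>x\<in>U. ((\<lambda>t. g (x(i := t))) has_real_derivative g' i x) (at (x i)))" "continuous_on U g"
    by auto
  have "((\<lambda>t. f (x(i := t)) * g (x(i := t))) has_real_derivative f' i x * g x + g' i x * f x) (at (x i))"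
    if "i < n" "x \<in> U" for i x
    using DERIV_mult[of "\<lambda>t. f (x(i := t))" "f' i x" "x i" UNIV "\<lambda>t. g (x(i := t))" "g' i x"] that f' g'
    by auto
  \<comment> \<open>The product rule involves the factors themselves at order \<open>k\<close>, one
    below the given order; \<open>Ck_SucD\<close> lowers them.\<close>
  moreover have "Ck n k U (\<lambda>x. f' i x * g x + g' i x * f x)" if "i < n" for i
    using that f'(1) g'(1) Ck_SucD[OF Suc.prems(1)] Ck_SucD[OF Suc.prems(2)]
    by (intro Ck_add Suc.IH) simp_all
  ultimately show ?case
    using f'(2) g'(2)
    unfolding Ck.simps(2)
    by (intro conjI continuous_on_mult exI[of _ "\<lambda>i x. f' i x * g x + g' i x * f x"]) blast+
qed

section \<open>The algebra of smooth functions on a manifold\<close>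

lemma smooth_on_subset: "smooth_on M U f \<Longrightarrow> S \<subseteq> U \<Longrightarrow> smooth_on M S f"
  unfolding smooth_on_def Cinf_Euclidean_def
  by (blast intro: Ck_subset)

lemma smooth_on_const: "smooth_on M U (\<lambda>x. c)"
  by (auto simp: smooth_on_def Cinf_Euclidean_def Ck_const)

lemma smooth_on_add: "smooth_on M U f \<Longrightarrow> smooth_on M U g \<Longrightarrow> smooth_on M U (\<lambda>x. f x + g x)"
  by (fastforce simp: smooth_on_def Cinf_Euclidean_def intro: Ck_add)

lemma smooth_on_mult: "smooth_on M U f \<Longrightarrow> smooth_on M U g \<Longrightarrow> smooth_on M U (\<lambda>x. f x * g x)"
  by (fastforce simp: smooth_on_def Cinf_Euclidean_def intro: Ck_mult)

lemma smooth_const [simp]: "(\<lambda>x. c) \<in> smooth_functions M"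
  by (simp add: smooth_functions_def smooth_on_const)

lemma smooth_zero [simp]: "0 \<in> smooth_functions M"
  by (simp add: zero_fun_def)

lemma smooth_add [simp]:
  "f \<in> smooth_functions M \<Longrightarrow> g \<in> smooth_functions M \<Longrightarrow> f + g \<in> smooth_functions M"
  by (simp add: smooth_functions_def smooth_on_add plus_fun_def)

lemma smooth_mult [simp]:
  "f \<in> smooth_functions M \<Longrightarrow> g \<in> smooth_functions M \<Longrightarrow> f * g \<in> smooth_functions M"
  by (simp add: smooth_functions_def smooth_on_mult times_fun_def)

lemma smooth_scaleR [simp]:
  assumes "f \<in> smooth_functions M" shows "c *\<^sub>R f \<in> smooth_functions M"
proof -
  have "c *\<^sub>R f = (\<lambda>x. c) * f" by (simp add: fun_eq_iff scaleR_fun_def)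
  then show ?thesis using assms by simp
qed

lemma smooth_minus [simp]: "f \<in> smooth_functions M \<Longrightarrow> - f \<in> smooth_functions M"
  using smooth_scaleR[of f M "-1"] by simp

lemma smooth_diff [simp]:
  "f \<in> smooth_functions M \<Longrightarrow> g \<in> smooth_functions M \<Longrightarrow> f - g \<in> smooth_functions M"
  using smooth_add[of f M "- g"] by simp

section \<open>Tangent vectors as derivations\<close>

lemma tangent_spaceI:
  assumes "\<And>f g. f \<in> smooth_functions M \<Longrightarrow> g \<in> smooth_functions M \<Longrightarrow> v (f + g) = v f + v g"
    and "\<And>c f. f \<in> smooth_functions M \<Longrightarrow> v (c *\<^sub>R f) = c * v f"
    and "\<And>f g. f \<in> smooth_functions M \<Longrightarrow> g \<in> smooth_functions M
      \<Longrightarrow> v (f * g) = f x * v g + g x * v f"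
    and "\<And>f. f \<notin> smooth_functions M \<Longrightarrow> v f = 0"
  shows "v \<in> tangent_space M x"
  using assms by (simp add: tangent_space_def)

lemma tangent_add:
  "v \<in> tangent_space M x \<Longrightarrow> f \<in> smooth_functions M \<Longrightarrow> g \<in> smooth_functions M
    \<Longrightarrow> v (f + g) = v f + v g"
  by (simp add: tangent_space_def)

lemma tangent_scaleR:
  "v \<in> tangent_space M x \<Longrightarrow> f \<in> smooth_functions M \<Longrightarrow> v (c *\<^sub>R f) = c * v f"
  by (auto simp: tangent_space_def)

lemma tangent_mult:
  "v \<in> tangent_space M x \<Longrightarrow> f \<in> smooth_functions M \<Longrightarrow> g \<in> smooth_functions M
    \<Longrightarrow> v (f * g) = f x * v g + g x * v f"
  by (simp add: tangent_space_def)

lemma tangent_zero: "v \<in> tangent_space M x \<Longrightarrow> v 0 = 0"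
  using tangent_scaleR[of v M x 0 0] by simp

lemma tangent_diff:
  assumes "v \<in> tangent_space M x" "f \<in> smooth_functions M" "g \<in> smooth_functions M"
  shows "v (f - g) = v f - v g"
  using tangent_add[of v M x f "(-1) *\<^sub>R g"] tangent_scaleR[of v M x g "-1"] assms by simp

text \<open>The Leibniz rule for the square of the constant function 1 gives
  \<open>v 1 = v 1 + v 1\<close>; the other constants are its multiples.\<close>

lemma tangent_const:
  assumes "v \<in> tangent_space M x" shows "v (\<lambda>y. c) = 0"
proof -
  have "v ((\<lambda>y. 1) * (\<lambda>y. 1)) = v (\<lambda>y. 1) + v (\<lambda>y. 1)"
    using tangent_mult[OF assms smooth_const smooth_const, of 1 1] by simp
  then have "v (\<lambda>y. 1) = 0" by (simp add: times_fun_def)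
  then have "v (c *\<^sub>R (\<lambda>y. 1)) = 0" using tangent_scaleR[OF assms smooth_const] by simp
  then show ?thesis by (simp add: scaleR_fun_def)
qed

lemma tangent_nonsmooth: "v \<in> tangent_space M x \<Longrightarrow> f \<notin> smooth_functions M \<Longrightarrow> v f = 0"
  by (simp add: tangent_space_def)

section \<open>Vector fields as a module over the smooth functions\<close>

lemma vector_fieldsI:
  assumes "\<And>x. X x \<in> tangent_space M x"
    and "\<And>f. f \<in> smooth_functions M \<Longrightarrow> vf_apply X f \<in> smooth_functions M"
  shows "X \<in> vector_fields M"
  using assms by (simp add: vector_fields_def)

lemma vf_tangent: "X \<in> vector_fields M \<Longrightarrow> X x \<in> tangent_space M x"
  by (simp add: vector_fields_def)

lemma vf_apply_smooth [simp]:
  "X \<in> vector_fields M \<Longrightarrow> f \<in> smooth_functions M \<Longrightarrow> vf_apply X f \<in> smooth_functions M"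
  by (simp add: vector_fields_def)

text \<open>Equality of vector fields means agreement on all real functions, smooth or not. Since
  derivations vanish off the smooth functions by convention, this settles the nonsmooth case in the
  bracket identities.\<close>

lemma vf_apply_nonsmooth: "X \<in> vector_fields M \<Longrightarrow> f \<notin> smooth_functions M \<Longrightarrow> vf_apply X f = 0"
  unfolding vf_apply_def fun_eq_iff zero_fun_apply by (blast intro: tangent_nonsmooth vf_tangent)

lemma vf_apply_const [simp]: "X \<in> vector_fields M \<Longrightarrow> vf_apply X (\<lambda>x. c) = 0"
  unfolding vf_apply_def fun_eq_iff zero_fun_apply by (blast intro: tangent_const vf_tangent)

text \<open>Real scalars act as constant functions, so statements about them follow from the module
  laws over the smooth functions.\<close>

lemma fmult_scaleR: "(\<lambda>x. c) \<cdot> s = c *\<^sub>R s"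
  by (simp add: fmult_def scaleR_fun_def)

lemma fmult_add: "f \<cdot> (s + t) = f \<cdot> s + f \<cdot> t"
  by (simp add: fmult_def fun_eq_iff scaleR_add_right)

lemma fmult_diff: "f \<cdot> (s - t) = f \<cdot> s - f \<cdot> t"
  by (simp add: fmult_def fun_eq_iff scaleR_diff_right)

lemma fmult_zero [simp]: "f \<cdot> 0 = 0" "0 \<cdot> s = 0"
  by (simp_all add: fmult_def fun_eq_iff)

lemma fmult_apply: "(f \<cdot> s) x = f x *\<^sub>R s x"
  by (simp add: fmult_def)

lemma scaleR_fun_apply: "(c *\<^sub>R f) x = c *\<^sub>R f x"
  by (simp add: scaleR_fun_def)

lemma vf_apply_fmult: "vf_apply (f \<cdot> X) g = f * vf_apply X g"
  by (rule ext) (simp add: vf_apply_def fmult_apply scaleR_fun_apply)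

lemma fmult_diff_left: "(f - g) \<cdot> s = f \<cdot> s - g \<cdot> s"
  by (simp add: fmult_def fun_eq_iff scaleR_diff_left)

lemma fmult_scaleR_right: "f \<cdot> (c *\<^sub>R s) = c *\<^sub>R (f \<cdot> s)"
  by (rule ext) (simp add: fmult_apply scaleR_fun_apply)

lemma fmult_one: "(\<lambda>x. 1) \<cdot> s = s"
  by (simp add: fmult_def)

lemma vf_add [simp]:
  assumes "X \<in> vector_fields M" "Y \<in> vector_fields M" shows "X + Y \<in> vector_fields M"
proof -
  have "vf_apply (X + Y) f = vf_apply X f + vf_apply Y f" for f by (rule ext) (simp add: vf_apply_def)
  then have "vf_apply (X + Y) f \<in> smooth_functions M" if "f \<in> smooth_functions M" for f
    using that assms by simp
  moreover have "(X + Y) x \<in> tangent_space M x" for x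
    using assms[THEN vf_tangent, of x]
    by (intro tangent_spaceI)
      (simp_all add: tangent_add tangent_scaleR tangent_mult tangent_nonsmooth distrib_left)
  ultimately show ?thesis by (blast intro: vector_fieldsI)
qed

lemma vf_fmult [simp]:
  assumes "X \<in> vector_fields M" "f \<in> smooth_functions M" shows "f \<cdot> X \<in> vector_fields M"
proof -
  have "(f \<cdot> X) x \<in> tangent_space M x" for x
    using vf_tangent[OF assms(1), of x]
    by (intro tangent_spaceI)
      (simp_all add: fmult_def scaleR_fun_def[of _ "X _"] tangent_add tangent_scaleR tangent_mult
        tangent_nonsmooth distrib_left mult.left_commute)
  then show ?thesis using assms by (intro vector_fieldsI) (simp_all only: vf_apply_fmult smooth_mult vf_apply_smooth)
qed

lemma vf_zero: "0 \<in> vector_fields M"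
proof (rule vector_fieldsI)
  fix x show "(0 :: 'a vector_field) x \<in> tangent_space M x"
    by (rule tangent_spaceI) simp_all
next
  fix f :: "'a \<Rightarrow> real"
  have "vf_apply 0 f = 0" by (rule ext) (simp add: vf_apply_def)
  then show "vf_apply 0 f \<in> smooth_functions M" by simp
qed

lemma vf_scaleR [simp]: "X \<in> vector_fields M \<Longrightarrow> c *\<^sub>R X \<in> vector_fields M"
  by (metis fmult_scaleR smooth_const vf_fmult)

lemma vf_diff [simp]: "X \<in> vector_fields M \<Longrightarrow> Y \<in> vector_fields M \<Longrightarrow> X - Y \<in> vector_fields M"
  using vf_add[of X M "(-1) *\<^sub>R Y"] vf_scaleR[of Y M "-1"] by simp

section \<open>The Lie bracket of vector fields\<close>

lemma vf_apply_bracket: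
  "X \<in> vector_fields M \<Longrightarrow> Y \<in> vector_fields M
    \<Longrightarrow> vf_apply (vf_bracket X Y) f = vf_apply X (vf_apply Y f) - vf_apply Y (vf_apply X f)"
  by (simp add: vf_apply_def vf_bracket_def fun_eq_iff)

lemma vf_apply_add:
  "X \<in> vector_fields M \<Longrightarrow> f \<in> smooth_functions M \<Longrightarrow> g \<in> smooth_functions M
    \<Longrightarrow> vf_apply X (f + g) = vf_apply X f + vf_apply X g"
  by (simp add: vf_apply_def fun_eq_iff tangent_add[OF vf_tangent])

lemma vf_apply_scaleR:
  "X \<in> vector_fields M \<Longrightarrow> f \<in> smooth_functions M \<Longrightarrow> vf_apply X (c *\<^sub>R f) = c *\<^sub>R vf_apply X f"
  by (simp add: vf_apply_def fun_eq_iff scaleR_fun_def[of _ "\<lambda>x. X x f"] tangent_scaleR[OF vf_tangent])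

lemma vf_apply_mult:
  "X \<in> vector_fields M \<Longrightarrow> f \<in> smooth_functions M \<Longrightarrow> g \<in> smooth_functions M
    \<Longrightarrow> vf_apply X (f * g) = f * vf_apply X g + g * vf_apply X f"
  by (simp add: vf_apply_def fun_eq_iff tangent_mult[OF vf_tangent])

lemma vf_bracket_closed [simp]:
  assumes X: "X \<in> vector_fields M" and Y: "Y \<in> vector_fields M"
  shows "vf_bracket X Y \<in> vector_fields M"
proof -
  have "vf_bracket X Y x \<in> tangent_space M x" for x
  proof (rule tangent_spaceI)
    note t = vf_tangent[OF X, of x] vf_tangent[OF Y, of x]
    fix f g c
    show "vf_bracket X Y x f = 0" if "f \<notin> smooth_functions M"
      using that X Y t by (simp add: vf_bracket_def vf_apply_nonsmooth[of _ M] tangent_zero)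
    assume f: "f \<in> smooth_functions M"
    show "vf_bracket X Y x (c *\<^sub>R f) = c * vf_bracket X Y x f"
      using f X Y t by (simp add: vf_bracket_def vf_apply_scaleR tangent_scaleR right_diff_distrib)
    assume g: "g \<in> smooth_functions M"
    show "vf_bracket X Y x (f + g) = vf_bracket X Y x f + vf_bracket X Y x g"
      using f g X Y t by (simp add: vf_bracket_def vf_apply_add tangent_add)
    \<comment> \<open>The mixed products of a derivative along \<open>X\<close> with one along
      \<open>Y\<close> are symmetric in the two fields, so they cancel in the commutator.\<close>
    show "vf_bracket X Y x (f * g) = f x * vf_bracket X Y x g + g x * vf_bracket X Y x f"
      using f g X Y t
      by (simp add: vf_bracket_def vf_apply_mult tangent_add tangent_mult)
        (simp add: vf_apply_def right_diff_distrib)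
  qed
  then show ?thesis
    using X Y by (intro vector_fieldsI) (simp_all only: vf_apply_bracket smooth_diff vf_apply_smooth)
qed

lemma vf_bracket_add_left:
  assumes "X \<in> vector_fields M" "Y \<in> vector_fields M" "Z \<in> vector_fields M"
  shows "vf_bracket (X + Y) Z = vf_bracket X Z + vf_bracket Y Z"
proof -
  have "(X + Y) x (vf_apply Z f) - Z x (vf_apply (X + Y) f)
      = X x (vf_apply Z f) - Z x (vf_apply X f) + (Y x (vf_apply Z f) - Z x (vf_apply Y f))" for x f
  proof (cases "f \<in> smooth_functions M")
    case True
    have "vf_apply (X + Y) f = vf_apply X f + vf_apply Y f" by (simp add: vf_apply_def fun_eq_iff)
    then show ?thesis using True assms tangent_add[OF vf_tangent[OF assms(3)], of "vf_apply X f" "vf_apply Y f" x]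
      by simp
  next
    case False then show ?thesis
      using assms vf_apply_nonsmooth[of _ M f] tangent_zero[OF vf_tangent] by (metis add.right_neutral diff_0_right vf_add)
  qed
  then show ?thesis by (intro ext) (simp only: vf_bracket_def plus_fun_apply)
qed

lemma vf_bracket_skew: "vf_bracket X Y = - vf_bracket Y X"
  by (simp add: vf_bracket_def fun_eq_iff)

lemma vf_bracket_add_right:
  assumes "X \<in> vector_fields M" "Y \<in> vector_fields M" "Z \<in> vector_fields M"
  shows "vf_bracket X (Y + Z) = vf_bracket X Y + vf_bracket X Z"
  using vf_bracket_add_left[OF assms(2,3,1)]
  unfolding vf_bracket_skew[of X "Y + Z"] vf_bracket_skew[of X Y] vf_bracket_skew[of X Z] by simp

lemma vf_bracket_fmult_right:
  assumes "X \<in> vector_fields M" "Y \<in> vector_fields M" "f \<in> smooth_functions M"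
  shows "vf_bracket X (f \<cdot> Y) = f \<cdot> vf_bracket X Y + vf_apply X f \<cdot> Y"
proof -
  have "X x (vf_apply (f \<cdot> Y) g) - (f \<cdot> Y) x (vf_apply X g)
      = f x * (X x (vf_apply Y g) - Y x (vf_apply X g)) + X x f * Y x g" for x g
  proof (cases "g \<in> smooth_functions M")
    case True
    have "X x (f * vf_apply Y g) = f x * X x (vf_apply Y g) + Y x g * X x f"
      using tangent_mult[OF vf_tangent[OF assms(1)] assms(3) vf_apply_smooth[OF assms(2) True], of x]
      unfolding vf_apply_def .
    then show ?thesis
      by (simp add: vf_apply_fmult fmult_apply scaleR_fun_apply right_diff_distrib)
  next
    case False
    then have "vf_apply (f \<cdot> Y) g = 0" "vf_apply X g = 0" "vf_apply Y g = 0" "Y x g = 0"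
      using assms vf_apply_nonsmooth[of _ M g] tangent_nonsmooth[OF vf_tangent[of Y M x], of g]
      by (simp_all add: vf_apply_fmult)
    then show ?thesis
      using assms by (simp add: tangent_zero[OF vf_tangent] fmult_apply scaleR_fun_apply)
  qed
  then show ?thesis
    by (intro ext)
      (simp only: vf_bracket_def plus_fun_apply fmult_apply scaleR_fun_apply vf_apply_def[of X f]
        real_scaleR_def)
qed

lemma vf_bracket_fmult_left:
  assumes "X \<in> vector_fields M" "Y \<in> vector_fields M" "f \<in> smooth_functions M"
  shows "vf_bracket (f \<cdot> X) Y = f \<cdot> vf_bracket X Y - vf_apply Y f \<cdot> X"
proof -
  have "vf_bracket (f \<cdot> X) Y = - (f \<cdot> vf_bracket Y X + vf_apply Y f \<cdot> X)"
    using vf_bracket_fmult_right[OF assms(2,1,3)]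
    unfolding vf_bracket_skew[of "f \<cdot> X" Y] by simp
  also have "\<dots> = f \<cdot> vf_bracket X Y - vf_apply Y f \<cdot> X"
    by (intro ext) (simp add: vf_bracket_def fmult_apply scaleR_fun_apply right_diff_distrib)
  finally show ?thesis .
qed

text \<open>On functions, brackets act as commutators, for which the identity is formal after
  expansion. Expanding needs additivity of derivations, which holds on smooth functions only, hence
  the case split.\<close>

lemma vf_bracket_jacobi:
  assumes "X \<in> vector_fields M" "Y \<in> vector_fields M" "Z \<in> vector_fields M"
  shows "vf_bracket (vf_bracket X Y) Z = vf_bracket X (vf_bracket Y Z) - vf_bracket Y (vf_bracket X Z)"
proof -
  have "vf_apply (vf_bracket (vf_bracket X Y) Z) f
     = vf_apply (vf_bracket X (vf_bracket Y Z)) f - vf_apply (vf_bracket Y (vf_bracket X Z)) f" for f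
  proof (cases "f \<in> smooth_functions M")
    case True
    have "vf_apply W (g - h) = vf_apply W g - vf_apply W h"
      if "W \<in> vector_fields M" "g \<in> smooth_functions M" "h \<in> smooth_functions M" for W g h
      using that by (simp add: vf_apply_def fun_eq_iff tangent_diff[OF vf_tangent])
    then show ?thesis using assms True by (simp add: vf_apply_bracket[where M = M])
  next
    case False then show ?thesis using assms by (simp add: vf_apply_nonsmooth[of _ M])
  qed
  then show ?thesis by (simp add: fun_eq_iff vf_apply_def)
qed

section \<open>Sections of a vector bundle as a module\<close>

lemma fibre_subspace:
  assumes "vector_bundle M E" shows "subspace (fibre E x)"
proof -
  from assms have "x \<in> (\<Union>(U, e)\<in>frames E. U)" by (simp add: vector_bundle_def)
  then obtain U e where "(U, e) \<in> frames E" "x \<in> U" by auto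
  with assms have "span ((\<lambda>i. e i x) ` {..<rank E}) = fibre E x"
    unfolding vector_bundle_def by blast
  then show ?thesis by (metis subspace_span)
qed

lemma section_coefficients:
  assumes "s \<in> sections M E" "(U, e) \<in> frames E"
  obtains a where "\<forall>i<rank E. smooth_on M U (a i)"
    "\<forall>x\<in>U. s x = (\<Sum>i<rank E. a i x *\<^sub>R e i x)"
  using assms by (fastforce simp: sections_def)

lemma sections_zero:
  assumes "vector_bundle M E" shows "0 \<in> sections M E"
  using subspace_0[OF fibre_subspace[OF assms]]
  by (auto simp: sections_def intro!: exI[of _ "\<lambda>i x. 0"] smooth_on_const)

lemma sections_add:
  assumes "vector_bundle M E" "s \<in> sections M E" "t \<in> sections M E"
  shows "s + t \<in> sections M E"
proof -
  have "\<exists>c. (\<forall>i<rank E. smooth_on M U (c i)) \<and> (\<forall>x\<in>U. (s + t) x = (\<Sum>i<rank E. c i x *\<^sub>R e i x))"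
    if "(U, e) \<in> frames E" for U e
  proof -
    from assms(2) that obtain a where
      "\<forall>i<rank E. smooth_on M U (a i)" "\<forall>x\<in>U. s x = (\<Sum>i<rank E. a i x *\<^sub>R e i x)"
      by (rule section_coefficients)
    moreover from assms(3) that obtain b where
      "\<forall>i<rank E. smooth_on M U (b i)" "\<forall>x\<in>U. t x = (\<Sum>i<rank E. b i x *\<^sub>R e i x)"
      by (rule section_coefficients)
    ultimately show ?thesis
      by (auto simp: scaleR_add_left sum.distrib intro!: exI[of _ "\<lambda>i x. a i x + b i x"] smooth_on_add)
  qed
  then show ?thesis
    using assms(2,3) subspace_add[OF fibre_subspace[OF assms(1)]] by (auto simp: sections_def)
qed

lemma sections_fmult:
  assumes "vector_bundle M E" "s \<in> sections M E" "f \<in> smooth_functions M"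
  shows "f \<cdot> s \<in> sections M E"
proof -
  have "\<exists>c. (\<forall>i<rank E. smooth_on M U (c i)) \<and> (\<forall>x\<in>U. (f \<cdot> s) x = (\<Sum>i<rank E. c i x *\<^sub>R e i x))"
    if "(U, e) \<in> frames E" for U e
  proof -
    from assms(2) that obtain a where
      "\<forall>i<rank E. smooth_on M U (a i)" "\<forall>x\<in>U. s x = (\<Sum>i<rank E. a i x *\<^sub>R e i x)"
      by (rule section_coefficients)
    moreover have "smooth_on M U f"
      using assms(3) by (auto simp: smooth_functions_def intro: smooth_on_subset)
    ultimately show ?thesis
      by (auto simp: fmult_def scaleR_sum_right intro!: exI[of _ "\<lambda>i x. f x * a i x"] smooth_on_mult)
  qed
  then show ?thesis
    using assms(2) subspace_scale[OF fibre_subspace[OF assms(1)]] by (auto simp: sections_def fmult_def)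
qed

lemma sections_scaleR:
  "vector_bundle M E \<Longrightarrow> s \<in> sections M E \<Longrightarrow> c *\<^sub>R s \<in> sections M E"
  by (metis fmult_scaleR sections_fmult smooth_const)

lemma sections_diff:
  "vector_bundle M E \<Longrightarrow> s \<in> sections M E \<Longrightarrow> t \<in> sections M E \<Longrightarrow> s - t \<in> sections M E"
  using sections_add[of M E s "(-1) *\<^sub>R t"] sections_scaleR[of M E t "-1"] by simp

section \<open>Forms of degree zero and one\<close>

text \<open>Maps such as connections are additive only on sections or vector fields, so the usual
  consequences of additivity are derived relative to a subset \<open>S\<close>.\<close>

lemma additive_zero:
  fixes F :: "'b::ab_group_add \<Rightarrow> 'c::ab_group_add"
  assumes "\<And>s t. s \<in> S \<Longrightarrow> t \<in> S \<Longrightarrow> F (s + t) = F s + F t" "0 \<in> S"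
  shows "F 0 = 0"
  using assms(1)[OF assms(2,2)] by simp

lemma additive_diff:
  fixes F :: "'b::ab_group_add \<Rightarrow> 'c::ab_group_add"
  assumes "\<And>s t. s \<in> S \<Longrightarrow> t \<in> S \<Longrightarrow> F (s + t) = F s + F t" "s - t \<in> S" "t \<in> S"
  shows "F (s - t) = F s - F t"
  using assms(1)[OF assms(2,3)] by (simp add: algebra_simps)

text \<open>A 1-form is fixed by its values on single vector fields. Fixing the default 0 on all
  other lists turns equations of forms into equations for each \<open>X\<close>.\<close>

definition one_form :: "'m manifold \<Rightarrow> ('m vector_field \<Rightarrow> 'w::real_vector) \<Rightarrow> ('m, 'w) form" where
  "one_form M g = (\<lambda>Xs. if length Xs = 1 \<and> set Xs \<subseteq> vector_fields M then g (hd Xs) else 0)"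

lemma one_form_cong:
  "(\<And>X. X \<in> vector_fields M \<Longrightarrow> g X = h X) \<Longrightarrow> one_form M g = one_form M h"
  by (rule ext) (auto simp: one_form_def length_Suc_conv)

lemma one_form_add: "one_form M g + one_form M h = one_form M (\<lambda>X. g X + h X)"
  by (rule ext) (simp add: one_form_def)

lemma one_form_diff: "one_form M g - one_form M h = one_form M (\<lambda>X. g X - h X)"
  by (rule ext) (simp add: one_form_def)

lemma one_form_scaleR: "c *\<^sub>R one_form M g = one_form M (\<lambda>X. c *\<^sub>R g X)"
  by (rule ext) (simp add: one_form_def scaleR_fun_apply)

lemma zero_form_add: "zero_form g + zero_form h = zero_form (g + h)"
  by (rule ext) (simp add: zero_form_def)

lemma zero_form_diff: "zero_form g - zero_form h = zero_form (g - h)"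
  by (rule ext) (simp add: zero_form_def)

lemma zero_form_scaleR: "c *\<^sub>R zero_form g = zero_form (c *\<^sub>R g)"
  by (rule ext) (simp add: zero_form_def scaleR_fun_apply)

lemma zero_form_eq_0_iff:
  fixes g :: "'w::real_vector"
  shows "zero_form g = (0 :: ('m, 'w) form) \<longleftrightarrow> g = 0"
proof
  assume "zero_form g = (0 :: ('m, 'w) form)"
  then have "zero_form g ([] :: 'm vector_field list) = 0" by simp
  then show "g = 0" by (simp add: zero_form_def)
qed (simp add: zero_form_def fun_eq_iff)

lemma contract_one_form: "X \<in> vector_fields M \<Longrightarrow> contract X (one_form M g) = zero_form (g X)"
  by (rule ext) (simp add: contract_def one_form_def zero_form_def)

lemma contract_zero_form: "contract X (zero_form g) = 0"
  by (rule ext) (simp add: contract_def zero_form_def)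

lemma one_form_of_form: "\<gamma> \<in> forms M W 1 \<Longrightarrow> \<gamma> = one_form M (\<lambda>X. \<gamma> [X])"
  by (rule ext) (auto simp: forms_def one_form_def length_Suc_conv)

text \<open>In degree 1 the alternating condition is vacuous and multilinearity concerns a single
  slot.\<close>

lemma one_form_in_forms:
  assumes "\<And>X. X \<in> vector_fields M \<Longrightarrow> g X \<in> secs W"
    and "\<And>f X Y. f \<in> smooth_functions M \<Longrightarrow> X \<in> vector_fields M \<Longrightarrow> Y \<in> vector_fields M
      \<Longrightarrow> g (f \<cdot> X + Y) = act W f (g X) + g Y"
  shows "one_form M g \<in> forms M W 1"
  using assms by (auto simp: forms_def one_form_def length_Suc_conv)

lemma form_singleton_secs: "\<gamma> \<in> forms M W 1 \<Longrightarrow> X \<in> vector_fields M \<Longrightarrow> \<gamma> [X] \<in> secs W"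
  by (auto simp: forms_def)

lemma form_singleton_linear:
  assumes "\<gamma> \<in> forms M W 1" "X \<in> vector_fields M" "Y \<in> vector_fields M" "f \<in> smooth_functions M"
  shows "\<gamma> [f \<cdot> X + Y] = act W f (\<gamma> [X]) + \<gamma> [Y]"
proof -
  have "\<forall>Xs i. length Xs = 1 \<and> set Xs \<subseteq> vector_fields M \<and> i < 1 \<longrightarrow>
      (\<forall>X\<in>vector_fields M. \<forall>Y\<in>vector_fields M. \<forall>f\<in>smooth_functions M.
         \<gamma> (Xs[i := f \<cdot> X + Y]) = act W f (\<gamma> (Xs[i := X])) + \<gamma> (Xs[i := Y]))"
    using assms(1) unfolding forms_def by blast
  from this[rule_format, of "[X]" 0 X Y f] assms show ?thesis by simp
qed

lemma cochain_eqI: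
  "(\<And>\<alpha>. fst c \<alpha> = fst b \<alpha>) \<Longrightarrow> (\<And>\<alpha>. snd c \<alpha> = snd b \<alpha>) \<Longrightarrow> c = b"
  by (rule prod_eqI; rule ext)

lemma zero_form_in_forms: "F \<in> secs W \<Longrightarrow> zero_form F \<in> forms M W 0"
  by (auto simp: forms_def zero_form_def)

lemma connection_plus_apply: "connection_plus N \<gamma> X \<xi> = N X \<xi> + \<gamma> [X] \<xi>"
  by (simp add: connection_plus_def)

section \<open>Algebroid representations\<close>

locale algebroid_rep =
  fixes M :: "'m::{t2_space, second_countable_topology} manifold"
    and A :: "('m, 'a::real_vector) lie_algebroid"
    and V :: "('m, 'v::real_vector) vbundle"
    and D :: "('m \<Rightarrow> 'a) \<Rightarrow> ('m \<Rightarrow> 'v) \<Rightarrow> 'm \<Rightarrow> 'v"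
  assumes algebroid: "lie_algebroid M A"
    and vbundle: "vector_bundle M V"
    and rep: "algebroid_representation M A (bundle_module M V) D"
begin

abbreviation "EndV \<equiv> End_module M V"
abbreviation "DEnd \<equiv> End_connection M V D"

section \<open>The algebroid, its anchor and its flat connection\<close>

lemma abundle: "vector_bundle M (abundle A)"
  using algebroid unfolding lie_algebroid_def by blast

lemmas asec_closed [simp] =
  sections_zero[OF abundle] sections_add[OF abundle] sections_diff[OF abundle]
  sections_fmult[OF abundle] sections_scaleR[OF abundle]

lemmas sec_closed [simp] =
  sections_zero[OF vbundle] sections_add[OF vbundle] sections_diff[OF vbundle]
  sections_fmult[OF vbundle] sections_scaleR[OF vbundle]

lemma rho_vf [simp]: "\<alpha> \<in> asections M A \<Longrightarrow> rho A \<alpha> \<in> vector_fields M"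
  using algebroid unfolding lie_algebroid_def by blast

lemma bracket_asec [simp]:
  "\<alpha> \<in> asections M A \<Longrightarrow> \<beta> \<in> asections M A \<Longrightarrow> bracket A \<alpha> \<beta> \<in> asections M A"
  using algebroid unfolding lie_algebroid_def by blast

lemma rho_bracket:
  "\<alpha> \<in> asections M A \<Longrightarrow> \<beta> \<in> asections M A
    \<Longrightarrow> rho A (bracket A \<alpha> \<beta>) = vf_bracket (rho A \<alpha>) (rho A \<beta>)"
  using algebroid unfolding lie_algebroid_def by blast

lemma anchor_linear:
  "u \<in> fibre (abundle A) x \<Longrightarrow> v \<in> fibre (abundle A) x
    \<Longrightarrow> anchor A x (a *\<^sub>R u + b *\<^sub>R v) = a *\<^sub>R anchor A x u + b *\<^sub>R anchor A x v"
  by (rule algebroid[unfolded lie_algebroid_def, THEN conjunct2, THEN conjunct2, THEN conjunct1,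
      rule_format])

lemma asec_fibre: "\<alpha> \<in> asections M A \<Longrightarrow> \<alpha> x \<in> fibre (abundle A) x"
  by (simp add: sections_def)

lemma rho_add:
  assumes "\<alpha> \<in> asections M A" "\<beta> \<in> asections M A"
  shows "rho A (\<alpha> + \<beta>) = rho A \<alpha> + rho A \<beta>"
  using anchor_linear[OF assms[THEN asec_fibre], of _ 1 1] by (intro ext) (simp add: rho_def)

lemma rho_fmult:
  assumes "\<alpha> \<in> asections M A" shows "rho A (f \<cdot> \<alpha>) = f \<cdot> rho A \<alpha>"
  using anchor_linear[OF asec_fibre[OF assms] asec_fibre[OF assms], of _ _ 0]
  by (intro ext) (simp add: rho_def fmult_apply)

lemma
  assumes "\<alpha> \<in> asections M A"
  shows D_closed [simp]: "\<xi> \<in> sections M V \<Longrightarrow> D \<alpha> \<xi> \<in> sections M V"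
    and D_add: "\<xi> \<in> sections M V \<Longrightarrow> \<eta> \<in> sections M V \<Longrightarrow> D \<alpha> (\<xi> + \<eta>) = D \<alpha> \<xi> + D \<alpha> \<eta>"
    and D_add_left: "\<beta> \<in> asections M A \<Longrightarrow> \<xi> \<in> sections M V \<Longrightarrow> D (\<alpha> + \<beta>) \<xi> = D \<alpha> \<xi> + D \<beta> \<xi>"
    and D_fmult: "f \<in> smooth_functions M \<Longrightarrow> \<xi> \<in> sections M V
      \<Longrightarrow> D \<alpha> (f \<cdot> \<xi>) = f \<cdot> D \<alpha> \<xi> + vf_apply (rho A \<alpha>) f \<cdot> \<xi>"
    and D_fmult_left: "f \<in> smooth_functions M \<Longrightarrow> \<xi> \<in> sections M V \<Longrightarrow> D (f \<cdot> \<alpha>) \<xi> = f \<cdot> D \<alpha> \<xi>"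
    and D_flat: "\<beta> \<in> asections M A \<Longrightarrow> \<xi> \<in> sections M V
      \<Longrightarrow> D (bracket A \<alpha> \<beta>) \<xi> = D \<alpha> (D \<beta> \<xi>) - D \<beta> (D \<alpha> \<xi>)"
  using rep assms unfolding algebroid_representation_def bundle_module_def section_module.simps
  by blast+

lemma D_zero: "\<alpha> \<in> asections M A \<Longrightarrow> D \<alpha> 0 = 0"
  by (rule additive_zero[of "sections M V" "D \<alpha>"]) (simp_all add: D_add)

lemma D_diff:
  "\<alpha> \<in> asections M A \<Longrightarrow> \<xi> \<in> sections M V \<Longrightarrow> \<eta> \<in> sections M V \<Longrightarrow> D \<alpha> (\<xi> - \<eta>) = D \<alpha> \<xi> - D \<alpha> \<eta>"
  by (rule additive_diff[of "sections M V" "D \<alpha>"]) (simp_all add: D_add)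

text \<open>Real homogeneity is not among the axioms of a representation: it is the Leibniz rule for
  a constant function, whose derivative along the anchor is 0.\<close>

lemma D_scaleR:
  "\<alpha> \<in> asections M A \<Longrightarrow> \<xi> \<in> sections M V \<Longrightarrow> D \<alpha> (c *\<^sub>R \<xi>) = c *\<^sub>R D \<alpha> \<xi>"
  using D_fmult[of \<alpha> "\<lambda>x. c" \<xi>] vf_apply_const[where M = M and X = "rho A \<alpha>"]
  by (simp add: fmult_scaleR)

section \<open>Endomorphisms of the module of sections\<close>

lemma End_secsD:
  assumes "F \<in> secs EndV"
  shows "\<xi> \<in> sections M V \<Longrightarrow> F \<xi> \<in> sections M V"
    and "\<xi> \<in> sections M V \<Longrightarrow> \<eta> \<in> sections M V \<Longrightarrow> F (\<xi> + \<eta>) = F \<xi> + F \<eta>"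
    and "f \<in> smooth_functions M \<Longrightarrow> \<xi> \<in> sections M V \<Longrightarrow> F (f \<cdot> \<xi>) = f \<cdot> F \<xi>"
    and "\<xi> \<notin> sections M V \<Longrightarrow> F \<xi> = 0"
  using assms by (simp_all add: End_module_def)

lemma End_secsI:
  assumes "\<And>\<xi>. \<xi> \<in> sections M V \<Longrightarrow> F \<xi> \<in> sections M V"
    and "\<And>\<xi> \<eta>. \<xi> \<in> sections M V \<Longrightarrow> \<eta> \<in> sections M V \<Longrightarrow> F (\<xi> + \<eta>) = F \<xi> + F \<eta>"
    and "\<And>f \<xi>. f \<in> smooth_functions M \<Longrightarrow> \<xi> \<in> sections M V \<Longrightarrow> F (f \<cdot> \<xi>) = f \<cdot> F \<xi>"
    and "\<And>\<xi>. \<xi> \<notin> sections M V \<Longrightarrow> F \<xi> = 0"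
  shows "F \<in> secs EndV"
  using assms by (simp add: End_module_def)

lemma End_add: "F \<in> secs EndV \<Longrightarrow> G \<in> secs EndV \<Longrightarrow> F + G \<in> secs EndV"
  by (rule End_secsI)
    (simp_all add: End_secsD[of F] End_secsD[of G] fmult_add)

lemma End_scaleR: "F \<in> secs EndV \<Longrightarrow> c *\<^sub>R F \<in> secs EndV"
  by (rule End_secsI)
    (simp_all add: End_secsD[of F] scaleR_fun_apply[of c F] scaleR_add_right fmult_scaleR_right)

lemma End_act: "act EndV f F = (\<lambda>\<xi>. f \<cdot> F \<xi>)"
  by (simp add: End_module_def)

section \<open>Operations on forms in degrees zero and one\<close>

lemma DEnd_zero: "\<alpha> \<in> asections M A \<Longrightarrow> DEnd \<alpha> 0 = 0"
  by (rule ext) (simp add: End_connection_def D_zero)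

lemma End_act_zero: "act EndV f 0 = 0"
  by (rule ext) (simp add: End_act)

lemma d_wedge_zero_form:
  "d_wedge M EndV f (zero_form F) = one_form M (\<lambda>X. act EndV (vf_apply X f) F)"
proof
  fix Xs
  show "d_wedge M EndV f (zero_form F) Xs = one_form M (\<lambda>X. act EndV (vf_apply X f) F) Xs"
  proof (cases "length Xs = 1 \<and> set Xs \<subseteq> vector_fields M")
    case True
    then show ?thesis by (auto simp: length_Suc_conv d_wedge_def zero_form_def one_form_def)
  next
    case False
    \<comment> \<open>Deleting one of at least two entries leaves a nonempty list, where a 0-form
      has its default value 0.\<close>
    have "(-1) ^ i *\<^sub>R act EndV (vf_apply (Xs ! i) f) (zero_form F (take i Xs @ drop (Suc i) Xs)) = 0"
      if "i < length Xs" "length Xs \<noteq> 1" for i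
      using that by (cases "take i Xs @ drop (Suc i) Xs = []") (auto simp: zero_form_def End_act_zero)
    with False show ?thesis by (auto simp: d_wedge_def one_form_def)
  qed
qed

lemma form_act_one_form: "form_act EndV f (one_form M g) = one_form M (\<lambda>X. act EndV f (g X))"
  by (rule ext) (simp add: form_act_def one_form_def End_act_zero)

lemma form_act_zero_form: "form_act EndV f (zero_form F) = zero_form (act EndV f F)"
  by (rule ext) (simp add: form_act_def zero_form_def End_act_zero)

lemma lie_derivative_one_form:
  assumes "\<alpha> \<in> asections M A"
  shows "lie_derivative M A DEnd \<alpha> (one_form M g)
    = one_form M (\<lambda>X. DEnd \<alpha> (g X) - g (vf_bracket (rho A \<alpha>) X))"
proof
  fix Xs
  show "lie_derivative M A DEnd \<alpha> (one_form M g) Xs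
    = one_form M (\<lambda>X. DEnd \<alpha> (g X) - g (vf_bracket (rho A \<alpha>) X)) Xs"
  proof (cases "length Xs = 1 \<and> set Xs \<subseteq> vector_fields M")
    case True
    then obtain X where "Xs = [X]" "X \<in> vector_fields M" by (auto simp: length_Suc_conv)
    then show ?thesis using assms by (simp add: lie_derivative_def one_form_def)
  next
    case False
    \<comment> \<open>On vector fields, replacing an entry keeps the wrong length, so every term has
      the default value 0, which \<open>DEnd\<close> preserves.\<close>
    then show ?thesis by (auto simp: lie_derivative_def one_form_def DEnd_zero[OF assms])
  qed
qed

lemma lie_derivative_zero_form:
  assumes "\<alpha> \<in> asections M A"
  shows "lie_derivative M A DEnd \<alpha> (zero_form F) = zero_form (DEnd \<alpha> F)"
  by (rule ext) (simp add: lie_derivative_def zero_form_def DEnd_zero[OF assms])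

section \<open>The coboundary on 1-forms and its cosets\<close>

text \<open>Membership in \<open>forms\<close> identifies \<gamma> with the \<open>one_form\<close>
  of its values, so the degree-one formulas apply; \<open>folded\<close> carries them back to
  \<gamma>.\<close>

lemma delta0_eq:
  assumes "\<gamma> \<in> forms M EndV 1"
  shows "delta0 M A DEnd \<gamma> =
     ((\<lambda>\<alpha>. if \<alpha> \<in> asections M A
           then one_form M (\<lambda>X. DEnd \<alpha> (\<gamma> [X]) - \<gamma> [vf_bracket (rho A \<alpha>) X]) else 0),
      (\<lambda>\<alpha>. if \<alpha> \<in> asections M A then zero_form (\<gamma> [rho A \<alpha>]) else 0))"
proof -
  have "lie_derivative M A DEnd \<alpha> \<gamma> = one_form M (\<lambda>X. DEnd \<alpha> (\<gamma> [X]) - \<gamma> [vf_bracket (rho A \<alpha>) X])"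
    if "\<alpha> \<in> asections M A" for \<alpha>
    using lie_derivative_one_form[OF that, of "\<lambda>X. \<gamma> [X]", folded one_form_of_form[OF assms]] .
  moreover have "contract (rho A \<alpha>) \<gamma> = zero_form (\<gamma> [rho A \<alpha>])" if "\<alpha> \<in> asections M A" for \<alpha>
    using contract_one_form[OF rho_vf[OF that], of "\<lambda>X. \<gamma> [X]", folded one_form_of_form[OF assms]] .
  ultimately show ?thesis by (simp add: delta0_def cong: if_cong)
qed

lemma forms1_add:
  assumes "\<gamma> \<in> forms M EndV 1" "\<gamma>' \<in> forms M EndV 1"
  shows "\<gamma> + \<gamma>' \<in> forms M EndV 1"
proof -
  have "one_form M (\<lambda>X. \<gamma> [X] + \<gamma>' [X]) \<in> forms M EndV 1"
    by (rule one_form_in_forms)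
      (simp_all add: End_add form_singleton_secs[OF assms(1)] form_singleton_secs[OF assms(2)]
        form_singleton_linear[OF assms(1)] form_singleton_linear[OF assms(2)] End_act fun_eq_iff
        fmult_add)
  then show ?thesis
    using one_form_add[of M "\<lambda>X. \<gamma> [X]" "\<lambda>X. \<gamma>' [X]"] one_form_of_form[OF assms(1)]
      one_form_of_form[OF assms(2)] by metis
qed

lemma forms1_scaleR:
  assumes "\<gamma> \<in> forms M EndV 1" shows "c *\<^sub>R \<gamma> \<in> forms M EndV 1"
proof -
  have "one_form M (\<lambda>X. c *\<^sub>R \<gamma> [X]) \<in> forms M EndV 1"
    by (rule one_form_in_forms)
      (simp_all add: End_scaleR form_singleton_secs[OF assms] form_singleton_linear[OF assms] End_act
        fun_eq_iff scaleR_fun_apply fmult_apply scaleR_add_right)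
  then show ?thesis
    using one_form_scaleR[of c M "\<lambda>X. \<gamma> [X]"] one_form_of_form[OF assms] by metis
qed

lemma forms1_zero: "0 \<in> forms M EndV 1"
proof -
  have "0 \<in> secs EndV" by (rule End_secsI) simp_all
  then have "one_form M (\<lambda>X. 0) \<in> forms M EndV 1"
    by (intro one_form_in_forms) (simp_all add: End_act fun_eq_iff)
  moreover have "one_form M (\<lambda>X. 0) = 0" by (rule ext) (simp add: one_form_def)
  ultimately show ?thesis by metis
qed

text \<open>Linearity of the coboundary makes its kernel a subspace and its image an additive group.
  As \<open>D\<close> is additive only on sections, the values of both forms must map sections to
  sections.\<close>

lemma delta0_add:
  assumes "\<gamma> \<in> forms M EndV 1" "\<gamma>' \<in> forms M EndV 1"
  shows "delta0 M A DEnd (\<gamma> + \<gamma>') = delta0 M A DEnd \<gamma> + delta0 M A DEnd \<gamma>'"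
proof -
  have eq: "DEnd \<alpha> (\<gamma> [X] + \<gamma>' [X]) = DEnd \<alpha> (\<gamma> [X]) + DEnd \<alpha> (\<gamma>' [X])"
    if "\<alpha> \<in> asections M A" "X \<in> vector_fields M" for \<alpha> X
    using that End_secsD(1)[OF form_singleton_secs[OF assms(1) that(2)]]
      End_secsD(1)[OF form_singleton_secs[OF assms(2) that(2)]]
    by (intro ext) (simp add: End_connection_def D_add)
  show ?thesis
    unfolding delta0_eq[OF assms(1)] delta0_eq[OF assms(2)] delta0_eq[OF forms1_add[OF assms]]
    by (rule cochain_eqI) (auto simp: eq one_form_add zero_form_add intro!: one_form_cong)
qed

lemma delta0_scaleR:
  assumes "\<gamma> \<in> forms M EndV 1"
  shows "delta0 M A DEnd (c *\<^sub>R \<gamma>) = c *\<^sub>R delta0 M A DEnd \<gamma>"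
proof -
  have eq: "DEnd \<alpha> (c *\<^sub>R \<gamma> [X]) = c *\<^sub>R DEnd \<alpha> (\<gamma> [X])"
    if "\<alpha> \<in> asections M A" "X \<in> vector_fields M" for \<alpha> X
    using that End_secsD(1)[OF form_singleton_secs[OF assms that(2)]]
    by (intro ext) (simp add: End_connection_def D_scaleR scaleR_fun_apply scaleR_diff_right)
  show ?thesis
    unfolding delta0_eq[OF assms] delta0_eq[OF forms1_scaleR[OF assms]]
    by (rule cochain_eqI)
      (auto simp: eq one_form_scaleR zero_form_scaleR scaleR_diff_right scaleR_fun_apply
        intro!: one_form_cong)
qed

lemma delta0_minus:
  "\<gamma> \<in> forms M EndV 1 \<Longrightarrow> delta0 M A DEnd (- \<gamma>) = - delta0 M A DEnd \<gamma>"
  using delta0_scaleR[of \<gamma> "-1"] by simp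

lemma forms1_minus: "\<gamma> \<in> forms M EndV 1 \<Longrightarrow> - \<gamma> \<in> forms M EndV 1"
  using forms1_scaleR[of \<gamma> "-1"] by simp

lemma subspace_invariant_forms: "subspace (invariant_forms M A EndV DEnd 1)"
  \<comment> \<open>Scalar 0 gives \<open>delta0\<close> of the zero form, so that 0 lies in the
    kernel.\<close>
  using delta0_scaleR[OF forms1_zero, of 0]
  by (simp add: subspace_def invariant_forms_def forms1_zero forms1_add forms1_scaleR delta0_add
      delta0_scaleR del: One_nat_def)

text \<open>The image of \<open>delta0\<close> is an additive group, so shifting the representative
  by one of its elements only relabels the coset: \<eta> is matched with \<eta> - \<gamma>, and in
  the other direction with \<eta> + \<gamma>.\<close>

lemma cohomology_class_diff_delta0:
  assumes "\<gamma> \<in> forms M EndV 1"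
  shows "cohomology_class M A EndV DEnd 1 (c - delta0 M A DEnd \<gamma>) = cohomology_class M A EndV DEnd 1 c"
proof -
  have "\<exists>b\<in>delta0 M A DEnd ` forms M EndV 1. c - delta0 M A DEnd \<gamma> + delta0 M A DEnd \<eta> = c + b"
    if "\<eta> \<in> forms M EndV 1" for \<eta>
  proof
    show "delta0 M A DEnd (\<eta> + - \<gamma>) \<in> delta0 M A DEnd ` forms M EndV 1"
      by (intro imageI forms1_add forms1_minus that assms)
    show "c - delta0 M A DEnd \<gamma> + delta0 M A DEnd \<eta> = c + delta0 M A DEnd (\<eta> + - \<gamma>)"
      unfolding delta0_add[OF that forms1_minus[OF assms]] delta0_minus[OF assms] by simp
  qed
  moreover have "\<exists>b\<in>delta0 M A DEnd ` forms M EndV 1. c + delta0 M A DEnd \<eta> = c - delta0 M A DEnd \<gamma> + b"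
    if "\<eta> \<in> forms M EndV 1" for \<eta>
  proof
    show "delta0 M A DEnd (\<eta> + \<gamma>) \<in> delta0 M A DEnd ` forms M EndV 1"
      by (intro imageI forms1_add that assms)
    show "c + delta0 M A DEnd \<eta> = c - delta0 M A DEnd \<gamma> + delta0 M A DEnd (\<eta> + \<gamma>)"
      unfolding delta0_add[OF that assms] by simp
  qed
  ultimately show ?thesis unfolding cohomology_class_def by blast
qed

end

section \<open>The invariance form of a linear connection\<close>

locale linear_connection = algebroid_rep M A V D
  for M :: "'m::{t2_space, second_countable_topology} manifold"
    and A :: "('m, 'a::real_vector) lie_algebroid"
    and V :: "('m, 'v::real_vector) vbundle"
    and D :: "('m \<Rightarrow> 'a) \<Rightarrow> ('m \<Rightarrow> 'v) \<Rightarrow> 'm \<Rightarrow> 'v" +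
  fixes N :: "('m, 'v) connection"
  assumes connection: "N \<in> linear_connections M V"
begin

section \<open>Calculus of a linear connection\<close>

lemma
  assumes "X \<in> vector_fields M"
  shows N_closed [simp]: "\<xi> \<in> sections M V \<Longrightarrow> N X \<xi> \<in> sections M V"
    and N_add: "\<xi> \<in> sections M V \<Longrightarrow> \<eta> \<in> sections M V \<Longrightarrow> N X (\<xi> + \<eta>) = N X \<xi> + N X \<eta>"
    and N_add_left: "Y \<in> vector_fields M \<Longrightarrow> \<xi> \<in> sections M V \<Longrightarrow> N (X + Y) \<xi> = N X \<xi> + N Y \<xi>"
    and N_fmult: "f \<in> smooth_functions M \<Longrightarrow> \<xi> \<in> sections M V
      \<Longrightarrow> N X (f \<cdot> \<xi>) = f \<cdot> N X \<xi> + vf_apply X f \<cdot> \<xi>"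
    and N_fmult_left: "f \<in> smooth_functions M \<Longrightarrow> \<xi> \<in> sections M V \<Longrightarrow> N (f \<cdot> X) \<xi> = f \<cdot> N X \<xi>"
  using connection assms unfolding linear_connections_def by blast+

lemma N_off: "X \<notin> vector_fields M \<or> \<xi> \<notin> sections M V \<Longrightarrow> N X \<xi> = 0"
  using connection unfolding linear_connections_def by blast

lemma N_zero: "X \<in> vector_fields M \<Longrightarrow> N X 0 = 0"
  by (rule additive_zero[of "sections M V" "N X"]) (simp_all add: N_add)

lemma N_diff:
  "X \<in> vector_fields M \<Longrightarrow> \<xi> \<in> sections M V \<Longrightarrow> \<eta> \<in> sections M V \<Longrightarrow> N X (\<xi> - \<eta>) = N X \<xi> - N X \<eta>"
  by (rule additive_diff[of "sections M V" "N X"]) (simp_all add: N_add)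

lemma N_diff_left:
  "X \<in> vector_fields M \<Longrightarrow> Y \<in> vector_fields M \<Longrightarrow> \<xi> \<in> sections M V \<Longrightarrow> N (X - Y) \<xi> = N X \<xi> - N Y \<xi>"
  by (rule additive_diff[of "vector_fields M" "\<lambda>X. N X \<xi>"]) (simp_all add: N_add_left)

section \<open>The two components of the invariance form\<close>

abbreviation "\<theta> \<equiv> theta M A V D N"

text \<open>Minus the Lie derivative of \<open>N\<close> along \<alpha> at \<open>X\<close>, that
  is, the formula for 1-forms applied formally to a connection. Each term contains \<open>N\<close>
  exactly once.\<close>

definition T :: "('m \<Rightarrow> 'a) \<Rightarrow> 'm vector_field \<Rightarrow> ('m \<Rightarrow> 'v) \<Rightarrow> 'm \<Rightarrow> 'v" where
  "T \<alpha> X = (\<lambda>\<xi>. if \<xi> \<in> sections M V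
     then N (vf_bracket (rho A \<alpha>) X) \<xi> - D \<alpha> (N X \<xi>) + N X (D \<alpha> \<xi>) else 0)"

text \<open>The curvature is quadratic in \<open>N\<close>, but its terms composing
  \<open>N X\<close> with \<open>N (rho A \<alpha>)\<close> cancel against those in the commutator
  of \<open>N X\<close> with \<open>theta\<close>.\<close>

lemma T_eq:
  assumes "\<alpha> \<in> asections M A"
  shows "d_End M V N (\<theta> \<alpha>) - contract (rho A \<alpha>) (curvature M V N) = one_form M (T \<alpha>)"
proof
  fix Xs
  show "(d_End M V N (\<theta> \<alpha>) - contract (rho A \<alpha>) (curvature M V N)) Xs = one_form M (T \<alpha>) Xs"
  proof (cases "length Xs = 1 \<and> set Xs \<subseteq> vector_fields M")
    case True
    then obtain X where "Xs = [X]" "X \<in> vector_fields M" by (auto simp: length_Suc_conv)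
    then show ?thesis
      using assms
      by (intro ext) (simp add: one_form_def d_End_def contract_def curvature_def End_connection_def
          theta_def T_def N_diff Let_def)
  next
    case False
    then show ?thesis by (auto simp: one_form_def d_End_def contract_def curvature_def)
  qed
qed

lemma invariance_form_eq:
  "invariance_form M A V D N =
     ((\<lambda>\<alpha>. if \<alpha> \<in> asections M A then one_form M (T \<alpha>) else 0),
      (\<lambda>\<alpha>. if \<alpha> \<in> asections M A then zero_form (\<theta> \<alpha>) else 0))"
  by (rule cochain_eqI) (simp_all add: invariance_form_def T_eq)

text \<open>\<open>D \<alpha>\<close> and \<open>N (rho A \<alpha>)\<close> obey the Leibniz rule
  with the same derivation, so the derivative terms cancel in the difference.\<close>

lemma theta_End: "\<alpha> \<in> asections M A \<Longrightarrow> \<theta> \<alpha> \<in> secs EndV"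
  by (rule End_secsI) (simp_all add: theta_def D_add N_add D_fmult N_fmult fmult_diff)

lemma theta_add:
  "\<alpha> \<in> asections M A \<Longrightarrow> \<beta> \<in> asections M A \<Longrightarrow> \<theta> (\<alpha> + \<beta>) = \<theta> \<alpha> + \<theta> \<beta>"
  by (rule ext) (simp add: theta_def rho_add D_add_left N_add_left)

lemma theta_fmult:
  "\<alpha> \<in> asections M A \<Longrightarrow> f \<in> smooth_functions M \<Longrightarrow> \<theta> (f \<cdot> \<alpha>) = act EndV f (\<theta> \<alpha>)"
  by (rule ext) (simp add: theta_def rho_fmult D_fmult_left N_fmult_left fmult_diff End_act)

text \<open>The second multiplicativity equation in degree 1. Flatness turns \<open>D\<close> along
  the bracket into a commutator; on the right, the two commutators of \<open>D \<alpha>\<close> with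
  \<open>N (rho A \<beta>)\<close> cancel.\<close>

lemma theta_bracket:
  "\<alpha> \<in> asections M A \<Longrightarrow> \<beta> \<in> asections M A
    \<Longrightarrow> \<theta> (bracket A \<alpha> \<beta>) = DEnd \<alpha> (\<theta> \<beta>) - T \<alpha> (rho A \<beta>)"
  by (rule ext) (simp add: theta_def T_def End_connection_def rho_bracket D_flat D_diff)

text \<open>The terms of \<open>T\<close> are differential operators, yet the sum is linear over
  functions: the leftover factor of \<xi> is the derivative of \<open>f\<close> along the bracket of
  \<open>rho A \<alpha>\<close> and \<open>X\<close> minus the commutator of these fields on
  \<open>f\<close>, which is 0.\<close>

lemma T_End:
  assumes "\<alpha> \<in> asections M A" "X \<in> vector_fields M" shows "T \<alpha> X \<in> secs EndV"
proof (rule End_secsI)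
  fix f \<xi> assume "f \<in> smooth_functions M" "\<xi> \<in> sections M V"
  then show "T \<alpha> X (f \<cdot> \<xi>) = f \<cdot> T \<alpha> X \<xi>"
    using assms
    by (simp add: T_def N_fmult D_fmult D_add N_add fmult_diff fmult_add fmult_diff_left
        vf_apply_bracket[where M = M])
qed (use assms in \<open>simp_all add: T_def D_add N_add\<close>)

text \<open>The derivative of \<open>f\<close> along \<open>rho A \<alpha>\<close> arises once from
  the bracket and once from the Leibniz rule for \<open>D\<close>, with opposite signs.\<close>

lemma T_linear:
  assumes "\<alpha> \<in> asections M A" "X \<in> vector_fields M" "Y \<in> vector_fields M" "f \<in> smooth_functions M"
  shows "T \<alpha> (f \<cdot> X + Y) = act EndV f (T \<alpha> X) + T \<alpha> Y"
  using assms
  by (intro ext) (simp add: T_def End_act vf_bracket_add_right[where M = M]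
      vf_bracket_fmult_right[where M = M] N_add_left N_fmult_left D_add D_fmult fmult_diff fmult_add)

lemma T_add:
  assumes "\<alpha> \<in> asections M A" "\<beta> \<in> asections M A" "X \<in> vector_fields M"
  shows "T (\<alpha> + \<beta>) X = T \<alpha> X + T \<beta> X"
  using assms
  by (intro ext) (simp add: T_def rho_add vf_bracket_add_left[where M = M] N_add_left D_add_left N_add)

text \<open>The derivative of \<open>f\<close> along \<open>X\<close> multiplies
  \<open>D \<alpha>\<close>, by the Leibniz rule for \<open>N\<close>, and minus
  \<open>N (rho A \<alpha>)\<close>, from the bracket. Together these are \<open>theta\<close>,
  which yields the wedge term of a Weil cochain.\<close>

lemma T_fmult:
  assumes "\<alpha> \<in> asections M A" "X \<in> vector_fields M" "f \<in> smooth_functions M"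
  shows "T (f \<cdot> \<alpha>) X = act EndV f (T \<alpha> X) + act EndV (vf_apply X f) (\<theta> \<alpha>)"
  using assms
  by (intro ext) (simp add: T_def End_act theta_def rho_fmult vf_bracket_fmult_left[where M = M]
      N_diff_left N_fmult_left D_fmult_left N_fmult fmult_diff fmult_add)

lemma T_scaleR:
  assumes "\<alpha> \<in> asections M A" "X \<in> vector_fields M"
  shows "T (c *\<^sub>R \<alpha>) X = c *\<^sub>R T \<alpha> X"
  using T_fmult[OF assms, of "\<lambda>x. c"] assms(2)
  by (simp add: fmult_scaleR End_act scaleR_fun_def[of c "T \<alpha> X"]) (simp add: fun_eq_iff)

text \<open>The first multiplicativity equation at \<open>X\<close>: the Jacobi identity splits the
  \<open>N\<close> term along the iterated bracket, and flatness of \<open>D\<close> handles the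
  commutator.\<close>

lemma T_bracket:
  assumes "\<alpha> \<in> asections M A" "\<beta> \<in> asections M A" "X \<in> vector_fields M"
  shows "T (bracket A \<alpha> \<beta>) X
    = DEnd \<alpha> (T \<beta> X) - T \<beta> (vf_bracket (rho A \<alpha>) X) - (DEnd \<beta> (T \<alpha> X) - T \<alpha> (vf_bracket (rho A \<beta>) X))"
  using assms
  by (intro ext) (simp add: T_def End_connection_def rho_bracket vf_bracket_jacobi[where M = M]
      N_diff_left D_flat D_diff D_add N_diff)

section \<open>Multiplicativity of the invariance form\<close>

lemma invariance_form_weil: "invariance_form M A V D N \<in> weil_cochains M A EndV 1"
proof -
  have "one_form M (T \<alpha>) \<in> forms M EndV 1" if "\<alpha> \<in> asections M A" for \<alpha>
    using that by (intro one_form_in_forms T_End T_linear)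
  moreover have "one_form M (T (a *\<^sub>R \<alpha> + b *\<^sub>R \<beta>)) = a *\<^sub>R one_form M (T \<alpha>) + b *\<^sub>R one_form M (T \<beta>)"
    if "\<alpha> \<in> asections M A" "\<beta> \<in> asections M A" for \<alpha> \<beta> a b
    unfolding one_form_scaleR one_form_add using that
    by (intro one_form_cong) (simp add: T_add T_scaleR)
  moreover have "one_form M (T (f \<cdot> \<alpha>))
      = form_act EndV f (one_form M (T \<alpha>)) + d_wedge M EndV f (zero_form (\<theta> \<alpha>))"
    if "\<alpha> \<in> asections M A" "f \<in> smooth_functions M" for f \<alpha>
    unfolding form_act_one_form d_wedge_zero_form one_form_add using that
    by (intro one_form_cong) (simp add: T_fmult)
  ultimately show ?thesis
    unfolding invariance_form_eq
    by (simp add: weil_cochains_def zero_form_in_forms theta_End theta_add zero_form_add theta_fmult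
        form_act_zero_form del: One_nat_def)
qed

text \<open>The first two equations are \<open>T_bracket\<close> and \<open>theta_bracket\<close>
  for forms; the third is trivial, since contracting a 0-form gives 0.\<close>

lemma invariance_form_im: "invariance_form M A V D N \<in> im_forms M A EndV DEnd 1"
proof -
  have "one_form M (T (bracket A \<alpha> \<beta>)) = lie_derivative M A DEnd \<alpha> (one_form M (T \<beta>))
      - lie_derivative M A DEnd \<beta> (one_form M (T \<alpha>))"
    if "\<alpha> \<in> asections M A" "\<beta> \<in> asections M A" for \<alpha> \<beta>
    unfolding lie_derivative_one_form[OF that(1)] lie_derivative_one_form[OF that(2)] one_form_diff
    using that by (intro one_form_cong) (simp add: T_bracket)
  moreover have "zero_form (\<theta> (bracket A \<alpha> \<beta>)) = lie_derivative M A DEnd \<alpha> (zero_form (\<theta> \<beta>))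
      - contract (rho A \<beta>) (one_form M (T \<alpha>))"
    if "\<alpha> \<in> asections M A" "\<beta> \<in> asections M A" for \<alpha> \<beta>
    using that
    by (simp add: lie_derivative_zero_form contract_one_form[where M = M] zero_form_diff theta_bracket)
  ultimately show ?thesis
    using invariance_form_weil unfolding invariance_form_eq
    by (simp add: im_forms_def contract_zero_form del: One_nat_def)
qed

section \<open>Affine dependence on the connection\<close>

text \<open>Each \<open>\<gamma> [X]\<close> is linear over functions, so adding it leaves the
  derivative term of the Leibniz rule unchanged.\<close>

lemma connection_plus_connection:
  assumes "\<gamma> \<in> forms M EndV 1"
  shows "connection_plus N \<gamma> \<in> linear_connections M V"
proof -
  note E = End_secsD[OF form_singleton_secs[OF assms]]
  note lin = form_singleton_linear[OF assms]
  \<comment> \<open>The axiom for forms has the joint shape \<open>f \<cdot> X + Y\<close>: the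
    constant \<open>f\<close> = 1 yields additivity, and then \<open>Y\<close> = 0 yields
    homogeneity.\<close>
  have add: "\<gamma> [X + Y] = \<gamma> [X] + \<gamma> [Y]" if "X \<in> vector_fields M" "Y \<in> vector_fields M" for X Y
    using lin[OF that smooth_const, of 1] by (simp add: fmult_one End_act)
  have "\<gamma> [0] = 0" using add[OF vf_zero vf_zero] by simp
  then have fmult: "\<gamma> [f \<cdot> X] = act EndV f (\<gamma> [X])"
    if "X \<in> vector_fields M" "f \<in> smooth_functions M" for f X
    using lin[OF that(1) vf_zero that(2)] by simp
  \<comment> \<open>A connection has the value 0 outside its domain, so both summands must vanish
    there.\<close>
  have off: "N X \<xi> + \<gamma> [X] \<xi> = 0" if "X \<notin> vector_fields M \<or> \<xi> \<notin> sections M V" for X \<xi>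
  proof (cases "X \<in> vector_fields M")
    case True
    then show ?thesis using that by (simp add: N_off E)
  next
    case False
    have "\<gamma> [X] = one_form M (\<lambda>X. \<gamma> [X]) [X]" by (rule fun_cong[OF one_form_of_form[OF assms]])
    then show ?thesis using False by (simp add: N_off one_form_def)
  qed
  show ?thesis
    unfolding linear_connections_def connection_plus_def mem_Collect_eq
    by (intro conjI ballI allI impI)
      (simp_all add: E add fmult off N_add N_add_left N_fmult N_fmult_left End_act fmult_add)
qed

text \<open>\<open>T\<close> and \<open>theta\<close> are affine in \<open>N\<close>, because
  \<open>N\<close> enters each of their terms at most once; the part linear in \<gamma> is minus
  \<open>delta0\<close>.\<close>

lemma invariance_form_plus:
  assumes "\<gamma> \<in> forms M EndV 1"
  shows "invariance_form M A V D (connection_plus N \<gamma>) = invariance_form M A V D N - delta0 M A DEnd \<gamma>"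
proof -
  interpret plus: linear_connection M A V D "connection_plus N \<gamma>"
    by unfold_locales (rule connection_plus_connection[OF assms])
  note E = End_secsD[OF form_singleton_secs[OF assms]]
  have "plus.T \<alpha> X = T \<alpha> X - (DEnd \<alpha> (\<gamma> [X]) - \<gamma> [vf_bracket (rho A \<alpha>) X])"
    if "\<alpha> \<in> asections M A" "X \<in> vector_fields M" for \<alpha> X
    using that
    by (intro ext) (simp add: plus.T_def T_def End_connection_def connection_plus_apply E D_add)
  moreover have "theta M A V D (connection_plus N \<gamma>) \<alpha> = \<theta> \<alpha> - \<gamma> [rho A \<alpha>]"
    if "\<alpha> \<in> asections M A" for \<alpha>
    using that by (intro ext) (simp add: theta_def connection_plus_apply E)
  ultimately show ?thesis
    unfolding plus.invariance_form_eq invariance_form_eq delta0_eq[OF assms]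
    by (intro cochain_eqI) (auto simp: one_form_diff zero_form_diff intro!: one_form_cong)
qed

text \<open>The first invariance condition is the vanishing of \<open>theta\<close>. Then its
  covariant derivative vanishes as well, and what remains of the first component is the curvature
  condition.\<close>

lemma invariant_iff:
  "N \<in> invariant_connections M A V D \<longleftrightarrow> invariance_form M A V D N = 0"
proof -
  have theta_iff: "(\<forall>\<xi>\<in>sections M V. D \<alpha> \<xi> = N (rho A \<alpha>) \<xi>) \<longleftrightarrow> \<theta> \<alpha> = 0" for \<alpha>
    by (auto simp: theta_def fun_eq_iff[of "theta _ _ _ _ _ _"] fun_eq_iff[of _ 0])
  have d0: "d_End M V N 0 = 0"
  proof
    fix Xs show "d_End M V N 0 Xs = 0 Xs"
    proof (cases "length Xs = 1 \<and> set Xs \<subseteq> vector_fields M")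
      case True
      then obtain X where "Xs = [X]" "X \<in> vector_fields M" by (auto simp: length_Suc_conv)
      then show ?thesis by (intro ext) (simp add: d_End_def End_connection_def N_zero)
    next
      case False
      then show ?thesis by (auto simp: d_End_def)
    qed
  qed
  have "invariance_form M A V D N = 0 \<longleftrightarrow>
      (\<forall>\<alpha>. fst (invariance_form M A V D N) \<alpha> = 0 \<and> snd (invariance_form M A V D N) \<alpha> = 0)"
    by (auto simp del: prod_eq_iff intro!: cochain_eqI)
  also have "\<dots> \<longleftrightarrow> (\<forall>\<alpha>\<in>asections M A. \<theta> \<alpha> = 0 \<and>
      d_End M V N (\<theta> \<alpha>) - contract (rho A \<alpha>) (curvature M V N) = 0)"
    by (auto simp: invariance_form_def zero_form_eq_0_iff)
  also have "\<dots> \<longleftrightarrow> (\<forall>\<alpha>\<in>asections M A. \<theta> \<alpha> = 0 \<and> contract (rho A \<alpha>) (curvature M V N) = 0)"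
    using d0 by (auto simp del: zero_fun_apply)
  finally show ?thesis
    using connection by (simp add: invariant_connections_def theta_iff)
qed

text \<open>The Leibniz terms of the two connections cancel, so their difference is a form with
  values in endomorphisms. Both being 0 off their domain, \<open>N'\<close> is recovered on all
  arguments.\<close>

lemma connection_difference:
  assumes "N' \<in> linear_connections M V"
  obtains \<gamma> where "\<gamma> \<in> forms M EndV 1" "connection_plus N \<gamma> = N'"
proof
  interpret N': linear_connection M A V D N' by unfold_locales (rule assms)
  let ?\<gamma> = "one_form M (\<lambda>X \<xi>. N' X \<xi> - N X \<xi>)"
  have off: "N' X \<xi> = 0 \<and> N X \<xi> = 0" if "X \<notin> vector_fields M \<or> \<xi> \<notin> sections M V" for X \<xi>
    using that N_off N'.N_off by blast
  have "(\<lambda>\<xi>. N' X \<xi> - N X \<xi>) \<in> secs EndV" if "X \<in> vector_fields M" for X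
    using that
    by (intro End_secsI)
      (simp_all add: off N_add N'.N_add N_fmult N'.N_fmult fmult_diff)
  moreover have "(\<lambda>\<xi>. N' (f \<cdot> X + Y) \<xi> - N (f \<cdot> X + Y) \<xi>)
      = act EndV f (\<lambda>\<xi>. N' X \<xi> - N X \<xi>) + (\<lambda>\<xi>. N' Y \<xi> - N Y \<xi>)"
    if "X \<in> vector_fields M" "Y \<in> vector_fields M" "f \<in> smooth_functions M" for f X Y
  proof
    fix \<xi>
    show "N' (f \<cdot> X + Y) \<xi> - N (f \<cdot> X + Y) \<xi>
      = (act EndV f (\<lambda>\<xi>. N' X \<xi> - N X \<xi>) + (\<lambda>\<xi>. N' Y \<xi> - N Y \<xi>)) \<xi>"
      using that by (cases "\<xi> \<in> sections M V")
        (simp_all add: off End_act N_add_left N'.N_add_left N_fmult_left N'.N_fmult_left fmult_diff)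
  qed
  ultimately show "?\<gamma> \<in> forms M EndV 1" by (intro one_form_in_forms)
  show "connection_plus N ?\<gamma> = N'"
  proof (intro ext[of "connection_plus N ?\<gamma>"] ext[of "connection_plus N ?\<gamma> _"])
    fix X \<xi> show "connection_plus N ?\<gamma> X \<xi> = N' X \<xi>"
      using off[of X \<xi>] by (cases "X \<in> vector_fields M") (simp_all add: connection_plus_def one_form_def)
  qed
qed

text \<open>Cancelling \<open>N\<close> leaves equality on single vector fields, and this determines
  a 1-form.\<close>

lemma connection_plus_inject:
  assumes "\<gamma> \<in> forms M EndV 1" "\<gamma>' \<in> forms M EndV 1" "connection_plus N \<gamma> = connection_plus N \<gamma>'"
  shows "\<gamma> = \<gamma>'"
proof -
  have "\<gamma> [X] = \<gamma>' [X]" for X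
  proof
    fix \<xi> show "\<gamma> [X] \<xi> = \<gamma>' [X] \<xi>"
      using fun_cong[OF fun_cong[OF assms(3)], of X \<xi>] by (simp add: connection_plus_def)
  qed
  then show ?thesis using one_form_of_form[OF assms(1)] one_form_of_form[OF assms(2)] by simp
qed

end

section \<open>The obstruction class\<close>

context algebroid_rep
begin

lemma linear_connectionI: "N \<in> linear_connections M V \<Longrightarrow> linear_connection M A V D N"
  by unfold_locales

lemma invariant_connections_linear:
  "N \<in> invariant_connections M A V D \<Longrightarrow> N \<in> linear_connections M V"
  by (simp add: invariant_connections_def)

lemma invariant_connections_eq:
  "invariant_connections M A V D
    = {N \<in> linear_connections M V. invariance_form M A V D N = 0}"
  using linear_connection.invariant_iff[OF linear_connectionI] invariant_connections_linear by blast

text \<open>Invariant connections are the zero set of an affine map on all linear connections with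
  linear part minus \<open>delta0\<close>, so they are modelled on its kernel.\<close>

lemma affine_invariant_connections:
  assumes "invariant_connections M A V D \<noteq> {}"
  shows "affine_space_over (invariant_forms M A EndV DEnd 1) (invariant_connections M A V D)
    connection_plus"
  unfolding affine_space_over_def
proof (intro conjI ballI)
  show "subspace (invariant_forms M A EndV DEnd 1)" by (rule subspace_invariant_forms)
  show "invariant_connections M A V D \<noteq> {}" by (rule assms)
next
  fix N \<gamma> assume N: "N \<in> invariant_connections M A V D" and "\<gamma> \<in> invariant_forms M A EndV DEnd 1"
  then have \<gamma>: "\<gamma> \<in> forms M EndV 1" "delta0 M A DEnd \<gamma> = 0" by (simp_all add: invariant_forms_def)
  interpret linear_connection M A V D N
    by (rule linear_connectionI[OF invariant_connections_linear[OF N]])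
  show "connection_plus N \<gamma> \<in> invariant_connections M A V D"
    using N connection_plus_connection[OF \<gamma>(1)] invariance_form_plus[OF \<gamma>(1)] \<gamma>(2)
    by (simp add: invariant_connections_eq)
next
  fix N show "connection_plus N 0 = N" by (simp add: connection_plus_def)
next
  fix N and \<gamma> \<gamma>' :: "('m, ('m \<Rightarrow> 'v) \<Rightarrow> 'm \<Rightarrow> 'v) form"
  show "connection_plus (connection_plus N \<gamma>) \<gamma>' = connection_plus N (\<gamma> + \<gamma>')"
    by (simp add: connection_plus_def add.assoc)
next
  fix N N' assume N: "N \<in> invariant_connections M A V D" and N': "N' \<in> invariant_connections M A V D"
  interpret linear_connection M A V D N
    by (rule linear_connectionI[OF invariant_connections_linear[OF N]])
  obtain \<gamma> where \<gamma>: "\<gamma> \<in> forms M EndV 1" "connection_plus N \<gamma> = N'"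
    using invariant_connections_linear[OF N'] by (rule connection_difference)
  have "delta0 M A DEnd \<gamma> = 0"
    using invariance_form_plus[OF \<gamma>(1)] N N' by (simp add: \<gamma>(2) invariant_connections_eq)
  then show "\<exists>!\<gamma>. \<gamma> \<in> invariant_forms M A EndV DEnd 1 \<and> connection_plus N \<gamma> = N'"
    using \<gamma> connection_plus_inject unfolding invariant_forms_def by blast
qed

text \<open>Two connections differ by a 1-form, hence their invariance forms by its
  coboundary.\<close>

lemma cohomology_class_invariance_form:
  assumes "N \<in> linear_connections M V" "N' \<in> linear_connections M V"
  shows "cohomology_class M A EndV DEnd 1 (invariance_form M A V D N')
    = cohomology_class M A EndV DEnd 1 (invariance_form M A V D N)"
proof -
  interpret linear_connection M A V D N by (rule linear_connectionI[OF assms(1)])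
  obtain \<gamma> where "\<gamma> \<in> forms M EndV 1" "connection_plus N \<gamma> = N'"
    using assms(2) by (rule connection_difference)
  then show ?thesis using invariance_form_plus cohomology_class_diff_delta0 by metis
qed

text \<open>The union of a nonempty family of equal classes is their common value.\<close>

lemma obstruction_eq:
  assumes "N \<in> linear_connections M V"
  shows "obstruction M A V D = cohomology_class M A EndV DEnd 1 (invariance_form M A V D N)"
  using assms cohomology_class_invariance_form unfolding obstruction_def by blast

text \<open>This serves to read membership off an equality of cosets and to see that no coset is
  empty.\<close>

lemma self_in_cohomology_class: "c \<in> cohomology_class M A EndV DEnd 1 c"
proof -
  have "delta0 M A DEnd 0 = 0" using delta0_scaleR[OF forms1_zero, of 0] by simp
  then have "0 \<in> delta0 M A DEnd ` forms M EndV 1" using forms1_zero by (metis imageI)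
  then show ?thesis unfolding cohomology_class_def by force
qed

text \<open>If the invariance form of \<open>N\<close> is the coboundary of \<gamma>, then shifting
  \<open>N\<close> by \<gamma> makes it 0. Conversely, the invariance form 0 of an invariant
  connection represents the obstruction.\<close>

lemma invariant_connection_exists_iff:
  "(\<exists>N. N \<in> invariant_connections M A V D)
    \<longleftrightarrow> obstruction M A V D = cohomology_class M A EndV DEnd 1 0"
proof
  assume "\<exists>N. N \<in> invariant_connections M A V D"
  then show "obstruction M A V D = cohomology_class M A EndV DEnd 1 0"
    using obstruction_eq by (auto simp: invariant_connections_eq)
next
  assume *: "obstruction M A V D = cohomology_class M A EndV DEnd 1 0"
  \<comment> \<open>A class is never empty, whereas the union over no connections is: a connection exists.\<close>
  then have "obstruction M A V D \<noteq> {}" using self_in_cohomology_class by blast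
  then obtain N where N: "N \<in> linear_connections M V" by (auto simp: obstruction_def)
  then interpret linear_connection M A V D N by (rule linear_connectionI)
  have "invariance_form M A V D N \<in> cohomology_class M A EndV DEnd 1 0"
    using self_in_cohomology_class * obstruction_eq[OF N] by metis
  then obtain \<gamma> where \<gamma>: "\<gamma> \<in> forms M EndV 1" "invariance_form M A V D N = delta0 M A DEnd \<gamma>"
    by (auto simp: cohomology_class_def)
  then have "connection_plus N \<gamma> \<in> invariant_connections M A V D"
    using connection_plus_connection invariance_form_plus by (simp add: invariant_connections_eq)
  then show "\<exists>N. N \<in> invariant_connections M A V D" by blast
qed

end

theorem theorem2p22:
  fixes M :: "'m::{t2_space, second_countable_topology} manifold"
    and A :: "('m, 'a::real_vector) lie_algebroid"
    and V :: "('m, 'v::real_vector) vbundle"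
    and nablaA :: "('m \<Rightarrow> 'a) \<Rightarrow> ('m \<Rightarrow> 'v) \<Rightarrow> 'm \<Rightarrow> 'v"
  assumes "smooth_manifold M"
    and "lie_algebroid M A"
    and "vector_bundle M V"
    and "algebroid_representation M A (bundle_module M V) nablaA"
  shows "(\<forall>N\<in>linear_connections M V.
            invariance_form M A V nablaA N
              \<in> im_forms M A (End_module M V) (End_connection M V nablaA) 1) \<and>
         (invariant_connections M A V nablaA \<noteq> {} \<longrightarrow>
            affine_space_over
              (invariant_forms M A (End_module M V) (End_connection M V nablaA) 1)
              (invariant_connections M A V nablaA) connection_plus) \<and>
         (\<forall>N\<in>linear_connections M V.
            cohomology_class M A (End_module M V) (End_connection M V nablaA) 1
                (invariance_form M A V nablaA N)
              \<in> H1 M A (End_module M V) (End_connection M V nablaA) 1 \<and>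
            obstruction M A V nablaA
              = cohomology_class M A (End_module M V) (End_connection M V nablaA) 1
                  (invariance_form M A V nablaA N)) \<and>
         ((\<exists>N. N \<in> invariant_connections M A V nablaA) \<longleftrightarrow>
            obstruction M A V nablaA
              = cohomology_class M A (End_module M V) (End_connection M V nablaA) 1 0)"
proof -
  interpret algebroid_rep M A V nablaA by unfold_locales (rule assms)+
  \<comment> \<open>Multiplicativity also places the class in \<open>H1\<close>, which consists of
    the classes of multiplicative forms.\<close>
  have "invariance_form M A V nablaA N \<in> im_forms M A EndV DEnd 1" if "N \<in> linear_connections M V" for N
    by (rule linear_connection.invariance_form_im[OF linear_connectionI[OF that]])
  then show ?thesis
    using affine_invariant_connections obstruction_eq invariant_connection_exists_iff
    unfolding H1_def by blast
qed

end
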